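(* Suppose that $\Gamma$ is a finite perfect group (i.e. it has no non-trivial abelian quotients) and let $\mathbb{G}=\widehat{\Gamma}$. Then there exists a quantum graph structure $A$ on $C(\mathbb{G})$ such that the classical automorphism group of $(\mathbb{G},A)$ is trivial, but the quantum automorphism group $\operatorname{Qut}(\mathbb{G},A)$ acts transitively.
   Context: $\widehat\Gamma$ is the finite quantum group with $C(\widehat\Gamma)=\mathbb{C}[\Gamma]$, $\Delta(\lambda_g)=\lambda_g\otimes\lambda_g$. $C(\mathbb{G})$ is a finite quantum set with $\psi$ the Haar functional normalized as the tracial 1-form (the tracial positive functional for which $mm^*=\mathrm{id}$ with respect to $\langle x,y\rangle=\psi(x^*y)$, $m$ the multiplication). A quantum graph structure is a linear map $A$ on $C(\mathbb{G})$ with $A\bullet A=A=\bar A$, where $A\bullet B=m(A\otimes B)m^*$ and $\bar Af=(A(f^* ))^*$. The classical automorphism group of $(\mathbb{X},A)$ consists of the $*$-automorphisms of $C(\mathbb{X})$ commuting with $A$ (it corresponds to the abelianization of the Hopf algebra of $\operatorname{Qut}(\mathbb{X},A)$). $\operatorname{Qut}(\mathbb{X},A)$ is the universal compact quantum group with a $\psi$-preserving action $\alpha:C(\mathbb{X})\to C(\mathbb{X})\otimes\mathcal{O}(\operatorname{Qut})$ with $(A\otimes\mathrm{id})\alpha=\alpha A$. An action is transitive (ergodic) if its fixed point algebra $\{x:\alpha(x)=x\otimes1\}$ equals $\mathbb{C}1$. *)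

theory Defs
  imports Complex_Main "HOL-Algebra.Algebra"
begin

definition perfect_group :: "'a monoid \<Rightarrow> bool" where
  "perfect_group G \<longleftrightarrow>
     (\<forall>H. H \<lhd> G \<longrightarrow> comm_group (G Mod H) \<longrightarrow> H = carrier G)"

section \<open>The finite quantum set C(hat Gamma) = C[Gamma]\<close>

text \<open>An element of C[Gamma] is written as the function f with x = sum of f g times lambda_g,
  i.e. an extensional function on the carrier of G.\<close>

definition cg_space :: "'a monoid \<Rightarrow> ('a \<Rightarrow> complex) set" where
  "cg_space G = extensional (carrier G)"

definition cg_add :: "'a monoid \<Rightarrow> ('a \<Rightarrow> complex) \<Rightarrow> ('a \<Rightarrow> complex) \<Rightarrow> ('a \<Rightarrow> complex)" where
  "cg_add G f g = restrict (\<lambda>x. f x + g x) (carrier G)"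

definition cg_smult :: "'a monoid \<Rightarrow> complex \<Rightarrow> ('a \<Rightarrow> complex) \<Rightarrow> ('a \<Rightarrow> complex)" where
  "cg_smult G c f = restrict (\<lambda>x. c * f x) (carrier G)"

text \<open>Product: lambda_h lambda_h' = lambda_(h h').\<close>
definition cg_mult :: "'a monoid \<Rightarrow> ('a \<Rightarrow> complex) \<Rightarrow> ('a \<Rightarrow> complex) \<Rightarrow> ('a \<Rightarrow> complex)" where
  "cg_mult G f g = restrict (\<lambda>l. \<Sum>h\<in>carrier G. f h * g (inv\<^bsub>G\<^esub> h \<otimes>\<^bsub>G\<^esub> l)) (carrier G)"

text \<open>Involution: lambda_g^* = lambda_(g^-1).\<close>
definition cg_star :: "'a monoid \<Rightarrow> ('a \<Rightarrow> complex) \<Rightarrow> ('a \<Rightarrow> complex)" where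
  "cg_star G f = restrict (\<lambda>h. cnj (f (inv\<^bsub>G\<^esub> h))) (carrier G)"

definition cg_one :: "'a monoid \<Rightarrow> ('a \<Rightarrow> complex)" where
  "cg_one G = restrict (\<lambda>h. if h = \<one>\<^bsub>G\<^esub> then 1 else 0) (carrier G)"

text \<open>Haar functional psi(lambda_g) = |Gamma| delta_(g,e): the tracial positive functional
  normalised so that m m^* = id w.r.t. <x,y> = psi(x^* y) (see cg_comult_adj and lemma below).\<close>
definition cg_psi :: "'a monoid \<Rightarrow> ('a \<Rightarrow> complex) \<Rightarrow> complex" where
  "cg_psi G f = of_nat (card (carrier G)) * f \<one>\<^bsub>G\<^esub>"

definition lin_op :: "'a monoid \<Rightarrow> ('a \<Rightarrow> 'a \<Rightarrow> complex) \<Rightarrow> ('a \<Rightarrow> complex) \<Rightarrow> ('a \<Rightarrow> complex)" where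
  "lin_op G a f = restrict (\<lambda>k. \<Sum>g\<in>carrier G. a k g * f g) (carrier G)"

text \<open>C[Gamma] tensor C[Gamma], elements written in the basis lambda_a tensor lambda_b.\<close>
definition cg_mult_map :: "'a monoid \<Rightarrow> ('a \<times> 'a \<Rightarrow> complex) \<Rightarrow> ('a \<Rightarrow> complex)" where
  "cg_mult_map G F = restrict (\<lambda>l. \<Sum>h\<in>carrier G. F (h, inv\<^bsub>G\<^esub> h \<otimes>\<^bsub>G\<^esub> l)) (carrier G)"

text \<open>The adjoint m^* of the multiplication with respect to psi and psi tensor psi.\<close>
definition cg_comult_adj :: "'a monoid \<Rightarrow> ('a \<Rightarrow> complex) \<Rightarrow> ('a \<times> 'a \<Rightarrow> complex)" where
  "cg_comult_adj G f = restrict (\<lambda>(a, b). f (a \<otimes>\<^bsub>G\<^esub> b) / of_nat (card (carrier G)))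
                                 (carrier G \<times> carrier G)"

definition tensor_op :: "'a monoid \<Rightarrow> ('a \<Rightarrow> 'a \<Rightarrow> complex) \<Rightarrow> ('a \<Rightarrow> 'a \<Rightarrow> complex)
                        \<Rightarrow> ('a \<times> 'a \<Rightarrow> complex) \<Rightarrow> ('a \<times> 'a \<Rightarrow> complex)" where
  "tensor_op G a b F = restrict (\<lambda>(k, k'). \<Sum>g\<in>carrier G. \<Sum>g'\<in>carrier G. a k g * b k' g' * F (g, g'))
                                (carrier G \<times> carrier G)"

text \<open>Sanity check of the normalisation of psi: m m^* = id.\<close>
lemma mm_adj_id:
  assumes "group G" "finite (carrier G)" "f \<in> cg_space G"
  shows "cg_mult_map G (cg_comult_adj G f) = f"
proof
  fix l
  show "cg_mult_map G (cg_comult_adj G f) l = f l"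
  proof (cases "l \<in> carrier G")
    case True
    interpret group G by fact
    have "cg_mult_map G (cg_comult_adj G f) l = (\<Sum>h\<in>carrier G. f l / of_nat (card (carrier G)))"
      unfolding cg_mult_map_def cg_comult_adj_def using True
      by (auto intro!: sum.cong simp: m_assoc[symmetric] r_inv)
    also have "\<dots> = f l" using assms(2) True by (auto simp: card_gt_0_iff)
    finally show ?thesis .
  next
    case False
    have "f l = undefined" using assms(3) False unfolding cg_space_def extensional_def by blast
    then show ?thesis using False unfolding cg_mult_map_def by simp
  qed
qed

definition schur_op :: "'a monoid \<Rightarrow> ('a \<Rightarrow> 'a \<Rightarrow> complex) \<Rightarrow> ('a \<Rightarrow> 'a \<Rightarrow> complex)
                        \<Rightarrow> ('a \<Rightarrow> complex) \<Rightarrow> ('a \<Rightarrow> complex)" where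
  "schur_op G a b f = cg_mult_map G (tensor_op G a b (cg_comult_adj G f))"

definition conj_op :: "'a monoid \<Rightarrow> ('a \<Rightarrow> 'a \<Rightarrow> complex) \<Rightarrow> ('a \<Rightarrow> complex) \<Rightarrow> ('a \<Rightarrow> complex)" where
  "conj_op G a f = cg_star G (lin_op G a (cg_star G f))"

definition quantum_graph :: "'a monoid \<Rightarrow> ('a \<Rightarrow> 'a \<Rightarrow> complex) \<Rightarrow> bool" where
  "quantum_graph G a \<longleftrightarrow>
     (\<forall>f\<in>cg_space G. schur_op G a a f = lin_op G a f) \<and>
     (\<forall>f\<in>cg_space G. conj_op G a f = lin_op G a f)"

definition star_automorphism :: "'a monoid \<Rightarrow> (('a \<Rightarrow> complex) \<Rightarrow> ('a \<Rightarrow> complex)) \<Rightarrow> bool" where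
  "star_automorphism G \<phi> \<longleftrightarrow>
     bij_betw \<phi> (cg_space G) (cg_space G) \<and>
     (\<forall>f\<in>cg_space G. \<forall>g\<in>cg_space G. \<phi> (cg_add G f g) = cg_add G (\<phi> f) (\<phi> g)) \<and>
     (\<forall>c. \<forall>f\<in>cg_space G. \<phi> (cg_smult G c f) = cg_smult G c (\<phi> f)) \<and>
     (\<forall>f\<in>cg_space G. \<forall>g\<in>cg_space G. \<phi> (cg_mult G f g) = cg_mult G (\<phi> f) (\<phi> g)) \<and>
     (\<forall>f\<in>cg_space G. \<phi> (cg_star G f) = cg_star G (\<phi> f)) \<and>
     \<phi> (cg_one G) = cg_one G"

definition classical_aut :: "'a monoid \<Rightarrow> ('a \<Rightarrow> 'a \<Rightarrow> complex) \<Rightarrow> (('a \<Rightarrow> complex) \<Rightarrow> ('a \<Rightarrow> complex)) set" where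
  "classical_aut G a = {\<phi>. star_automorphism G \<phi> \<and>
                           (\<forall>f\<in>cg_space G. \<phi> (lin_op G a f) = lin_op G a (\<phi> f))}"

text \<open>Words in the generators x and their adjoints x^* (flag True), coefficient functions.\<close>
type_synonym 'x ncpoly = "('x \<times> bool) list \<Rightarrow> complex"

definition nc_zero :: "'x ncpoly" where "nc_zero = (\<lambda>w. 0)"
definition nc_one :: "'x ncpoly" where "nc_one = (\<lambda>w. if w = [] then 1 else 0)"
definition nc_gen :: "'x \<Rightarrow> 'x ncpoly" where "nc_gen x = (\<lambda>w. if w = [(x, False)] then 1 else 0)"
definition nc_add :: "'x ncpoly \<Rightarrow> 'x ncpoly \<Rightarrow> 'x ncpoly" where "nc_add p q = (\<lambda>w. p w + q w)"
definition nc_sub :: "'x ncpoly \<Rightarrow> 'x ncpoly \<Rightarrow> 'x ncpoly" where "nc_sub p q = (\<lambda>w. p w - q w)"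
definition nc_smult :: "complex \<Rightarrow> 'x ncpoly \<Rightarrow> 'x ncpoly" where "nc_smult c p = (\<lambda>w. c * p w)"
definition nc_mult :: "'x ncpoly \<Rightarrow> 'x ncpoly \<Rightarrow> 'x ncpoly" where
  "nc_mult p q = (\<lambda>w. \<Sum>i\<le>length w. p (take i w) * q (drop i w))"
definition nc_star :: "'x ncpoly \<Rightarrow> 'x ncpoly" where
  "nc_star p = (\<lambda>w. cnj (p (rev (map (\<lambda>(x, b). (x, \<not> b)) w))))"
definition nc_finite :: "'x ncpoly \<Rightarrow> bool" where
  "nc_finite p \<longleftrightarrow> finite {w. p w \<noteq> 0}"

inductive_set star_ideal :: "'x ncpoly set \<Rightarrow> 'x ncpoly set" for R where
  zero: "nc_zero \<in> star_ideal R"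
| rel: "r \<in> R \<Longrightarrow> nc_finite p \<Longrightarrow> nc_finite q \<Longrightarrow> nc_mult (nc_mult p r) q \<in> star_ideal R"
| rel_star: "r \<in> R \<Longrightarrow> nc_finite p \<Longrightarrow> nc_finite q \<Longrightarrow> nc_mult (nc_mult p (nc_star r)) q \<in> star_ideal R"
| add: "p \<in> star_ideal R \<Longrightarrow> q \<in> star_ideal R \<Longrightarrow> nc_add p q \<in> star_ideal R"
| smult: "p \<in> star_ideal R \<Longrightarrow> nc_smult c p \<in> star_ideal R"

text \<open>O(Qut) is the universal unital *-algebra generated by u_(h,g) (h, g in Gamma) such that
  alpha(lambda_g) = sum_h lambda_h tensor u_(h,g) is a unital *-homomorphism
  C[Gamma] -> C[Gamma] tensor O, psi-preserving, commuting with A, with u unitary.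
  Elements of C[Gamma] tensor O are written as functions Gamma -> O (coefficients of lambda_h).\<close>

type_synonym 'a qpoly = "('a \<times> 'a) ncpoly"

definition coact :: "'a monoid \<Rightarrow> ('a \<Rightarrow> complex) \<Rightarrow> 'a \<Rightarrow> 'a qpoly" where
  "coact G f = (\<lambda>h w. \<Sum>g\<in>carrier G. f g * nc_gen (h, g) w)"

definition t_mult :: "'a monoid \<Rightarrow> ('a \<Rightarrow> 'a qpoly) \<Rightarrow> ('a \<Rightarrow> 'a qpoly) \<Rightarrow> 'a \<Rightarrow> 'a qpoly" where
  "t_mult G F H = (\<lambda>l w. \<Sum>h\<in>carrier G. nc_mult (F h) (H (inv\<^bsub>G\<^esub> h \<otimes>\<^bsub>G\<^esub> l)) w)"

definition t_star :: "'a monoid \<Rightarrow> ('a \<Rightarrow> 'a qpoly) \<Rightarrow> 'a \<Rightarrow> 'a qpoly" where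
  "t_star G F = (\<lambda>h. nc_star (F (inv\<^bsub>G\<^esub> h)))"

definition t_one :: "'a monoid \<Rightarrow> 'a \<Rightarrow> 'a qpoly" where
  "t_one G = (\<lambda>h. if h = \<one>\<^bsub>G\<^esub> then nc_one else nc_zero)"

definition t_psi :: "'a monoid \<Rightarrow> ('a \<Rightarrow> 'a qpoly) \<Rightarrow> 'a qpoly" where
  "t_psi G F = nc_smult (of_nat (card (carrier G))) (F \<one>\<^bsub>G\<^esub>)"

definition t_op :: "'a monoid \<Rightarrow> ('a \<Rightarrow> 'a \<Rightarrow> complex) \<Rightarrow> ('a \<Rightarrow> 'a qpoly) \<Rightarrow> 'a \<Rightarrow> 'a qpoly" where
  "t_op G a F = (\<lambda>k w. \<Sum>h\<in>carrier G. a k h * F h w)"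

definition qut_rels :: "'a monoid \<Rightarrow> ('a \<Rightarrow> 'a \<Rightarrow> complex) \<Rightarrow> 'a qpoly set" where
  "qut_rels G a =
     \<comment> \<open>multiplicative\<close>
     (\<Union>f\<in>cg_space G. \<Union>f'\<in>cg_space G. (\<lambda>h. nc_sub (coact G (cg_mult G f f') h)
                                       (t_mult G (coact G f) (coact G f') h)) ` carrier G)
     \<comment> \<open>*-preserving\<close>
   \<union> (\<Union>f\<in>cg_space G. (\<lambda>h. nc_sub (coact G (cg_star G f) h) (t_star G (coact G f) h)) ` carrier G)
     \<comment> \<open>unital\<close>
   \<union> (\<lambda>h. nc_sub (coact G (cg_one G) h) (t_one G h)) ` carrier G
     \<comment> \<open>psi-preserving\<close>
   \<union> (\<lambda>f. nc_sub (t_psi G (coact G f)) (nc_smult (cg_psi G f) nc_one)) ` cg_space G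
     \<comment> \<open>commuting with A\<close>
   \<union> (\<Union>f\<in>cg_space G. (\<lambda>k. nc_sub (t_op G a (coact G f) k) (coact G (lin_op G a f) k)) ` carrier G)
     \<comment> \<open>u unitary: u^* u = 1 and u u^* = 1\<close>
   \<union> (\<lambda>(g, k). nc_sub (\<lambda>w. \<Sum>h\<in>carrier G. nc_mult (nc_star (nc_gen (h, g))) (nc_gen (h, k)) w)
                       (if g = k then nc_one else nc_zero)) ` (carrier G \<times> carrier G)
   \<union> (\<lambda>(g, k). nc_sub (\<lambda>w. \<Sum>h\<in>carrier G. nc_mult (nc_gen (g, h)) (nc_star (nc_gen (k, h))) w)
                       (if g = k then nc_one else nc_zero)) ` (carrier G \<times> carrier G)"

definition qut_fixed_points :: "'a monoid \<Rightarrow> ('a \<Rightarrow> 'a \<Rightarrow> complex) \<Rightarrow> ('a \<Rightarrow> complex) set" where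
  "qut_fixed_points G a = {c \<in> cg_space G. \<forall>h\<in>carrier G.
       nc_sub (coact G c h) (nc_smult (c h) nc_one) \<in> star_ideal (qut_rels G a)}"

definition qut_transitive :: "'a monoid \<Rightarrow> ('a \<Rightarrow> 'a \<Rightarrow> complex) \<Rightarrow> bool" where
  "qut_transitive G a \<longleftrightarrow> qut_fixed_points G a = {cg_smult G z (cg_one G) | z. True}"

end

(* For a function q on the group that is a self-adjoint idempotent for convolution, the diagonal
   operator A lambda_g = n q(g) lambda_g, n the order of the group, is a quantum graph. The
   translation action lambda_g |-> lambda_g (x) lambda_g commutes with A and is ergodic, so Qut is
   always transitive. If moreover q(g) differs from all other values of q for every non-central g,
   a classical automorphism rescales lambda_g for non-central g; every central element is a product
   of two non-central ones, so the scaling factors form a character of the perfect group, which is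
   trivial.

   Such a q comes from a projection p maximising the number of separated pairs of coefficients
   within the projections whose commutators have the same annihilator as the whole commutator
   ideal. If p does not separate (g, h), neither does any nearby unitary conjugate, which forces
   w = lambda_(g^-1) - lambda_(h^-1) to commute with the left ideal generated by all [s, p]. Then
   each [w, t] annihilates the commutator ideal, hence is fixed by right translation by the perfect
   group, and having trace zero it vanishes: w is central and so is g. *)

theory Submission
  imports Defs "HOL-Computational_Algebra.Polynomial"
begin

section \<open>A ring containing the group algebra\<close>

text \<open>A self-adjoint idempotent cannot be perturbed coefficient by coefficient, so it is
  deformed by unitary conjugation, along the circles \<open>1 + sc (w - 1) * r\<close> with
  \<open>r\<close> a projection and \<open>w\<close> on the unit circle. Each coefficient is then a
  Laurent polynomial in \<open>w\<close> with exponents -1, 0, 1: "nearby" becomes "for all but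
  finitely many \<open>w\<close>", and neither topology nor differentiation enters. Since
  projections span the algebra, these circles reach the commutators [s, p] for all s. Conjugation
  does not move a central projection; this is why the commutators with \<open>p\<close> have to
  generate a large ideal. Separation is claimed only at non-central g because for central g and h
  the element w is central anyway, and commutators carry no information about it. The factor n in A
  compensates for the division by n in the adjoint of the multiplication.\<close>

typedef 'a cend = "{f :: ('a \<Rightarrow> complex) \<Rightarrow> 'a \<Rightarrow> complex.
    (\<forall>u v. f (\<lambda>x. u x + v x) = (\<lambda>x. f u x + f v x)) \<and> (\<forall>c u. f (\<lambda>x. c * u x) = (\<lambda>x. c * f u x))}"
  by (rule exI[of _ id]) auto

setup_lifting type_definition_cend

text \<open>The group algebra depends on the set \<open>carrier G\<close>, which a HOL type cannot
  do, so it is realised inside the linear endomorphisms of the functions on the whole type. As an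
  instance of \<open>ring_1\<close> this type lets \<open>algebra_simps\<close> settle the
  noncommutative identities below.\<close>

instantiation cend :: (type) ring_1
begin

lift_definition zero_cend :: "'a cend" is "\<lambda>u x. 0" by auto
lift_definition one_cend :: "'a cend" is "\<lambda>u. u" by auto
lift_definition plus_cend :: "'a cend \<Rightarrow> 'a cend \<Rightarrow> 'a cend" is "\<lambda>f g u x. f u x + g u x"
  by (auto simp: algebra_simps)
lift_definition minus_cend :: "'a cend \<Rightarrow> 'a cend \<Rightarrow> 'a cend" is "\<lambda>f g u x. f u x - g u x"
  by (auto simp: algebra_simps)
lift_definition uminus_cend :: "'a cend \<Rightarrow> 'a cend" is "\<lambda>f u x. - f u x"
  by (auto simp: algebra_simps)
lift_definition times_cend :: "'a cend \<Rightarrow> 'a cend \<Rightarrow> 'a cend" is "\<lambda>f g u. f (g u)"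
  by (auto simp: algebra_simps)

instance
proof
  show "(0 :: 'a cend) \<noteq> 1"
  proof (transfer, rule notI)
    assume "(\<lambda>(u :: 'a \<Rightarrow> complex) x. 0 :: complex) = (\<lambda>u. u)"
    then have "(\<lambda>x :: 'a. 0 :: complex) = (\<lambda>x. 1)" by (rule fun_cong)
    then show False by (simp add: fun_eq_iff)
  qed
qed (transfer; auto simp: algebra_simps)+

end

lift_definition cend_scalar :: "complex \<Rightarrow> 'a cend" is "\<lambda>c u x. c * u x"
  by (auto simp: algebra_simps)

text \<open>The left regular representation, extended by the identity on coordinates outside the
  carrier so that the neutral element acts as 1.\<close>

lift_definition cend_transl :: "'a monoid \<Rightarrow> 'a \<Rightarrow> 'a cend" is
  "\<lambda>G g u x. if x \<in> carrier G then u (inv\<^bsub>G\<^esub> g \<otimes>\<^bsub>G\<^esub> x) else u x"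
  by auto

locale group_ring = group G for G :: "'a monoid" (structure) +
  fixes L :: "'a \<Rightarrow> 'r :: ring_1" and sc :: "complex \<Rightarrow> 'r"
  assumes fin: "finite (carrier G)"
    and L_mult: "g \<in> carrier G \<Longrightarrow> h \<in> carrier G \<Longrightarrow> L (g \<otimes> h) = L g * L h"
    and L_one: "L \<one> = 1"
    and sc_add: "sc (c + d) = sc c + sc d"
    and sc_mult: "sc (c * d) = sc c * sc d"
    and sc_one: "sc 1 = 1"
    and sc_comm: "sc c * x = x * sc c"
    and indep: "(\<Sum>g\<in>carrier G. sc (u g) * L g) = 0 \<Longrightarrow> g \<in> carrier G \<Longrightarrow> u g = 0"

lemma group_ring_cend:
  assumes "group G" "finite (carrier G)"
  shows "group_ring G (cend_transl G) cend_scalar"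
proof -
  interpret group G by fact
  show ?thesis
  proof
    fix u :: "'a \<Rightarrow> complex" and g
    assume 0: "(\<Sum>g\<in>carrier G. cend_scalar (u g) * cend_transl G g) = 0" and g: "g \<in> carrier G"
    \<comment> \<open>Applied to the point mass at the neutral element, the combination returns its
      own coefficients.\<close>
    define d where "d = (\<lambda>x. if x = \<one>\<^bsub>G\<^esub> then 1 else 0 :: complex)"
    have rep: "Rep_cend (\<Sum>g\<in>S. cend_scalar (u g) * cend_transl G g) d x =
        (\<Sum>g\<in>S. u g * d (inv\<^bsub>G\<^esub> g \<otimes>\<^bsub>G\<^esub> x))" if "finite S" "x \<in> carrier G" for S x
      using that by (induction S rule: finite_induct)
        (auto simp: zero_cend.rep_eq plus_cend.rep_eq times_cend.rep_eq cend_scalar.rep_eq cend_transl.rep_eq)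
    have "0 = (\<Sum>h\<in>carrier G. u h * d (inv\<^bsub>G\<^esub> h \<otimes>\<^bsub>G\<^esub> g))"
      using rep[OF assms(2) g] 0 by (simp add: zero_cend.rep_eq)
    also have "\<dots> = (\<Sum>h\<in>carrier G. if h = g then u h else 0)"
    proof (rule sum.cong[OF refl])
      fix h assume h: "h \<in> carrier G"
      have "inv\<^bsub>G\<^esub> h \<otimes>\<^bsub>G\<^esub> g = \<one>\<^bsub>G\<^esub> \<longleftrightarrow> h = g"
        using g h inv_equality[of "inv\<^bsub>G\<^esub> h" g] inv_inv by fastforce
      then show "u h * d (inv\<^bsub>G\<^esub> h \<otimes>\<^bsub>G\<^esub> g) = (if h = g then u h else 0)"
        by (simp add: d_def)
    qed
    also have "\<dots> = u g" using assms(2) g by simp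
    finally show "u g = 0" by simp
  next
    fix g h assume gh: "g \<in> carrier G" "h \<in> carrier G"
    have "Rep_cend (cend_transl G (g \<otimes>\<^bsub>G\<^esub> h)) u x = Rep_cend (cend_transl G g * cend_transl G h) u x" for u x
      using gh by (simp add: times_cend.rep_eq cend_transl.rep_eq inv_mult_group m_assoc)
    then show "cend_transl G (g \<otimes>\<^bsub>G\<^esub> h) = cend_transl G g * cend_transl G h"
      by (simp add: fun_eq_iff flip: Rep_cend_inject)
  next
    have "Rep_cend (cend_transl G \<one>\<^bsub>G\<^esub>) u x = Rep_cend 1 u x" for u x
      by (simp add: one_cend.rep_eq cend_transl.rep_eq)
    then show "cend_transl G \<one>\<^bsub>G\<^esub> = 1"
      by (simp add: fun_eq_iff flip: Rep_cend_inject)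
  next
    fix c and x :: "'a cend"
    show "cend_scalar c * x = x * cend_scalar c" by transfer auto
  qed (fact assms | (transfer; auto simp: algebra_simps))+
qed

section \<open>Coefficients, involution and trace of the group algebra\<close>

context group_ring
begin

lemma sum_inv: "(\<Sum>g\<in>carrier G. f (inv g)) = (\<Sum>g\<in>carrier G. f g)"
  for f :: "'a \<Rightarrow> 'b :: comm_monoid_add"
  by (rule sum.reindex_bij_witness[of _ "m_inv G" "m_inv G"]) auto

lemma sum_transl: "h \<in> carrier G \<Longrightarrow> (\<Sum>g\<in>carrier G. f (h \<otimes> g)) = (\<Sum>g\<in>carrier G. f g)"
  for f :: "'a \<Rightarrow> 'b :: comm_monoid_add"
  by (rule sum.reindex_bij_witness[of _ "\<lambda>g. inv h \<otimes> g" "\<lambda>g. h \<otimes> g"])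
    (auto simp: m_assoc[symmetric])

lemma sc_0: "sc 0 = 0"
  using sc_add[of 0 0] by simp

lemma sc_minus: "sc (- c) = - sc c"
  using sc_add[of c "- c"] by (simp add: sc_0 eq_neg_iff_add_eq_0 add.commute)

lemma sc_diff: "sc (c - d) = sc c - sc d"
  using sc_add[of c "- d"] by (simp add: sc_minus)

lemma sc_sum: "sc (sum f S) = (\<Sum>i\<in>S. sc (f i))"
  by (induction S rule: infinite_finite_induct) (auto simp: sc_0 sc_add)

lemma sc_left_comm: "x * (sc c * y) = sc c * (x * y)"
  by (metis sc_comm mult.assoc)

definition emb :: "('a \<Rightarrow> complex) \<Rightarrow> 'r" where
  "emb u = (\<Sum>g\<in>carrier G. sc (u g) * L g)"

text \<open>\<open>coef\<close>, \<open>star\<close> and \<open>tau\<close> below are meaningful only on \<open>A\<close>, the copy of the group algebra in \<open>'r\<close>.\<close>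

definition A :: "'r set" where
  "A = range emb"

definition coef :: "'r \<Rightarrow> 'a \<Rightarrow> complex" where
  "coef x = (SOME u. emb u = x)"

definition star :: "'r \<Rightarrow> 'r" where
  "star x = emb (\<lambda>g. cnj (coef x (inv g)))"

definition tau :: "'r \<Rightarrow> complex" where
  "tau x = coef x \<one>"

lemma emb_in_A [simp]: "emb u \<in> A"
  by (simp add: A_def)

lemma emb_coef: "x \<in> A \<Longrightarrow> emb (coef x) = x"
  unfolding A_def coef_def by (rule someI_ex[of "\<lambda>u. emb u = x"]) blast

lemma emb_cong: "(\<And>g. g \<in> carrier G \<Longrightarrow> u g = v g) \<Longrightarrow> emb u = emb v"
  unfolding emb_def by (auto intro: sum.cong)

lemma emb_add: "emb u + emb v = emb (\<lambda>g. u g + v g)"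
  unfolding emb_def by (simp add: sum.distrib sc_add algebra_simps)

lemma emb_diff: "emb u - emb v = emb (\<lambda>g. u g - v g)"
  unfolding emb_def by (simp add: sum_subtractf sc_diff algebra_simps)

lemma sc_emb: "sc c * emb u = emb (\<lambda>g. c * u g)"
  unfolding emb_def by (simp add: sum_distrib_left sc_mult mult.assoc)

lemma coef_emb:
  assumes "g \<in> carrier G"
  shows "coef (emb u) g = u g"
proof -
  have "emb (coef (emb u)) = emb u" by (simp add: emb_coef)
  then have "emb (\<lambda>g. coef (emb u) g - u g) = 0" by (simp add: emb_diff[symmetric])
  then show ?thesis using indep[of "\<lambda>g. coef (emb u) g - u g" g] assms by (simp add: emb_def)
qed

lemma emb_L: "g \<in> carrier G \<Longrightarrow> L g = emb (\<lambda>h. if h = g then 1 else 0)"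
proof -
  assume g: "g \<in> carrier G"
  have "emb (\<lambda>h. if h = g then 1 else 0) = (\<Sum>h\<in>carrier G. if h = g then L h else 0)"
    unfolding emb_def by (intro sum.cong) (auto simp: sc_0 sc_one)
  then show ?thesis using g fin by simp
qed

lemma emb_mult: "emb u * emb v = emb (\<lambda>l. \<Sum>h\<in>carrier G. u h * v (inv h \<otimes> l))"
proof -
  have "emb (\<lambda>l. \<Sum>h\<in>carrier G. u h * v (inv h \<otimes> l))
      = (\<Sum>l\<in>carrier G. \<Sum>h\<in>carrier G. sc (u h * v (inv h \<otimes> l)) * L l)"
    unfolding emb_def by (simp add: sc_sum sum_distrib_right)
  also have "\<dots> = (\<Sum>h\<in>carrier G. \<Sum>l\<in>carrier G. sc (u h * v (inv h \<otimes> l)) * L l)"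
    by (rule sum.swap)
  also have "\<dots> = (\<Sum>h\<in>carrier G. \<Sum>k\<in>carrier G. sc (u h * v (inv h \<otimes> (h \<otimes> k))) * L (h \<otimes> k))"
    by (intro sum.cong refl sum_transl[symmetric])
  also have "\<dots> = (\<Sum>h\<in>carrier G. \<Sum>k\<in>carrier G. (sc (u h) * L h) * (sc (v k) * L k))"
  proof (intro sum.cong refl)
    fix h k assume hk: "h \<in> carrier G" "k \<in> carrier G"
    then have "inv h \<otimes> (h \<otimes> k) = k" by (simp add: m_assoc[symmetric])
    moreover have "L h * (sc (v k) * L k) = sc (v k) * (L h * L k)" by (rule sc_left_comm)
    ultimately show "sc (u h * v (inv h \<otimes> (h \<otimes> k))) * L (h \<otimes> k) = (sc (u h) * L h) * (sc (v k) * L k)"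
      using hk by (simp only: L_mult sc_mult mult.assoc)
  qed
  also have "\<dots> = emb u * emb v" by (simp add: emb_def sum_product)
  finally show ?thesis by simp
qed

lemma A_L [simp]: "g \<in> carrier G \<Longrightarrow> L g \<in> A"
  by (simp add: emb_L)

lemma A_one [simp]: "1 \<in> A"
  using A_L[of \<one>] by (simp add: L_one)

lemma A_mult [simp]: "x \<in> A \<Longrightarrow> y \<in> A \<Longrightarrow> x * y \<in> A"
  unfolding A_def by (auto simp: emb_mult)

lemma A_add [simp]: "x \<in> A \<Longrightarrow> y \<in> A \<Longrightarrow> x + y \<in> A"
  unfolding A_def by (auto simp: emb_add)

lemma A_diff [simp]: "x \<in> A \<Longrightarrow> y \<in> A \<Longrightarrow> x - y \<in> A"
  unfolding A_def by (auto simp: emb_diff)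

lemma A_zero [simp]: "0 \<in> A"
  using A_diff[OF A_one A_one] by simp

lemma A_sc_mult [simp]: "x \<in> A \<Longrightarrow> sc c * x \<in> A"
  unfolding A_def by (auto simp: sc_emb)

lemma A_sc [simp]: "sc c \<in> A"
  using A_sc_mult[OF A_one] by simp

lemma A_sum [simp]: "(\<And>i. i \<in> S \<Longrightarrow> f i \<in> A) \<Longrightarrow> sum f S \<in> A"
  by (induction S rule: infinite_finite_induct) auto

lemma A_star [simp]: "star x \<in> A"
  by (simp add: star_def)

lemma A_eqI: "x \<in> A \<Longrightarrow> y \<in> A \<Longrightarrow> (\<And>g. g \<in> carrier G \<Longrightarrow> coef x g = coef y g) \<Longrightarrow> x = y"
  using emb_cong[of "coef x" "coef y"] by (simp add: emb_coef)

lemma A_expand: "x \<in> A \<Longrightarrow> x = (\<Sum>g\<in>carrier G. sc (coef x g) * L g)"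
  using emb_coef by (simp add: emb_def)

lemma coef_add: "x \<in> A \<Longrightarrow> y \<in> A \<Longrightarrow> g \<in> carrier G \<Longrightarrow> coef (x + y) g = coef x g + coef y g"
  unfolding A_def by (auto simp: emb_add coef_emb)

lemma coef_diff: "x \<in> A \<Longrightarrow> y \<in> A \<Longrightarrow> g \<in> carrier G \<Longrightarrow> coef (x - y) g = coef x g - coef y g"
  unfolding A_def by (auto simp: emb_diff coef_emb)

lemma coef_sc: "x \<in> A \<Longrightarrow> g \<in> carrier G \<Longrightarrow> coef (sc c * x) g = c * coef x g"
  unfolding A_def by (auto simp: sc_emb coef_emb)

lemma coef_zero: "g \<in> carrier G \<Longrightarrow> coef 0 g = 0"
  using coef_diff[of 0 0 g] by simp

lemma coef_L: "g \<in> carrier G \<Longrightarrow> h \<in> carrier G \<Longrightarrow> coef (L g) h = (if h = g then 1 else 0)"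
  by (simp add: emb_L coef_emb)

lemma coef_mult:
  "x \<in> A \<Longrightarrow> y \<in> A \<Longrightarrow> l \<in> carrier G \<Longrightarrow>
    coef (x * y) l = (\<Sum>h\<in>carrier G. coef x h * coef y (inv h \<otimes> l))"
  using coef_emb[of l] emb_mult[of "coef x" "coef y"] by (simp add: emb_coef)

lemma coef_star: "g \<in> carrier G \<Longrightarrow> coef (star x) g = cnj (coef x (inv g))"
  by (simp add: star_def coef_emb)

lemma star_add: "x \<in> A \<Longrightarrow> y \<in> A \<Longrightarrow> star (x + y) = star x + star y"
  by (rule A_eqI) (auto simp: coef_star coef_add)

lemma star_diff: "x \<in> A \<Longrightarrow> y \<in> A \<Longrightarrow> star (x - y) = star x - star y"
  by (rule A_eqI) (auto simp: coef_star coef_diff)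

lemma star_sc_mult: "x \<in> A \<Longrightarrow> star (sc c * x) = sc (cnj c) * star x"
  by (rule A_eqI) (auto simp: coef_star coef_sc)

lemma star_star: "x \<in> A \<Longrightarrow> star (star x) = x"
  by (rule A_eqI) (auto simp: coef_star)

lemma star_L: "g \<in> carrier G \<Longrightarrow> star (L g) = L (inv g)"
  by (rule A_eqI) (auto simp: coef_star coef_L)

lemma star_one: "star 1 = 1"
  using star_L[of \<one>] by (simp add: L_one)

lemma star_zero: "star 0 = 0"
  using star_diff[of 0 0] by simp

lemma star_mult:
  assumes "x \<in> A" "y \<in> A"
  shows "star (x * y) = star y * star x"
proof (rule A_eqI)
  fix l assume l: "l \<in> carrier G"
  have "coef (star y * star x) l = (\<Sum>h\<in>carrier G. cnj (coef y (inv h)) * cnj (coef x (inv (inv h \<otimes> l))))"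
    using assms l by (simp add: coef_mult coef_star)
  also have "\<dots> = (\<Sum>k\<in>carrier G. cnj (coef y (inv (l \<otimes> k))) * cnj (coef x (inv (inv (l \<otimes> k) \<otimes> l))))"
    by (rule sum_transl[symmetric, OF l])
  also have "\<dots> = (\<Sum>k\<in>carrier G. cnj (coef x k) * cnj (coef y (inv k \<otimes> inv l)))"
  proof (rule sum.cong[OF refl])
    fix k assume k: "k \<in> carrier G"
    have "inv (inv (l \<otimes> k) \<otimes> l) = k" using k l by (simp add: inv_mult_group m_assoc)
    then show "cnj (coef y (inv (l \<otimes> k))) * cnj (coef x (inv (inv (l \<otimes> k) \<otimes> l)))
       = cnj (coef x k) * cnj (coef y (inv k \<otimes> inv l))" using k l by (simp add: inv_mult_group)
  qed
  also have "\<dots> = coef (star (x * y)) l"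
    using assms l by (simp add: coef_mult coef_star)
  finally show "coef (star (x * y)) l = coef (star y * star x) l" by simp
qed (use assms in auto)

lemma tau_add: "x \<in> A \<Longrightarrow> y \<in> A \<Longrightarrow> tau (x + y) = tau x + tau y"
  by (simp add: tau_def coef_add)

lemma tau_diff: "x \<in> A \<Longrightarrow> y \<in> A \<Longrightarrow> tau (x - y) = tau x - tau y"
  by (simp add: tau_def coef_diff)

lemma tau_sc: "x \<in> A \<Longrightarrow> tau (sc c * x) = c * tau x"
  by (simp add: tau_def coef_sc)

lemma tau_zero: "tau 0 = 0"
  by (simp add: tau_def coef_zero)

lemma tau_mult: "x \<in> A \<Longrightarrow> y \<in> A \<Longrightarrow> tau (x * y) = (\<Sum>h\<in>carrier G. coef x h * coef y (inv h))"
  by (simp add: tau_def coef_mult)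

lemma tau_comm:
  assumes "x \<in> A" "y \<in> A"
  shows "tau (x * y) = tau (y * x)"
proof -
  have "tau (y * x) = (\<Sum>h\<in>carrier G. coef y (inv h) * coef x (inv (inv h)))"
    unfolding tau_mult[OF assms(2,1)] by (rule sum_inv[symmetric])
  then show ?thesis using assms by (simp add: tau_mult mult.commute)
qed

lemma tau_L_mult: "x \<in> A \<Longrightarrow> g \<in> carrier G \<Longrightarrow> tau (L (inv g) * x) = coef x g"
proof -
  assume x: "x \<in> A" and g: "g \<in> carrier G"
  have "tau (L (inv g) * x) = (\<Sum>h\<in>carrier G. if h = inv g then coef x (inv h) else 0)"
    using x g by (simp add: tau_mult coef_L) (rule sum.cong, auto)
  then show ?thesis using fin g by simp
qed

lemma tau_nondeg: "x \<in> A \<Longrightarrow> (\<And>s. s \<in> A \<Longrightarrow> tau (s * x) = 0) \<Longrightarrow> x = 0"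
  by (rule A_eqI) (auto simp: tau_L_mult[symmetric] coef_zero tau_zero)

lemma tau_star_mult_self:
  assumes "x \<in> A" "tau (star x * x) = 0"
  shows "x = 0"
proof (rule A_eqI)
  fix g assume g: "g \<in> carrier G"
  have "tau (star x * x) = (\<Sum>h\<in>carrier G. cnj (coef x (inv h)) * coef x (inv h))"
    using assms by (simp add: tau_mult coef_star)
  also have "\<dots> = (\<Sum>h\<in>carrier G. cnj (coef x h) * coef x h)" by (rule sum_inv)
  also have "\<dots> = of_real (\<Sum>h\<in>carrier G. (cmod (coef x h))\<^sup>2)"
    by (auto simp: complex_norm_square[unfolded of_real_power] intro!: sum.cong mult.commute)
  finally have "(\<Sum>h\<in>carrier G. (cmod (coef x h))\<^sup>2) = 0" using assms(2) by (metis of_real_eq_0_iff)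
  then show "coef x g = coef 0 g" using fin g by (simp add: sum_nonneg_eq_0_iff coef_zero)
qed (use assms in auto)

end

section \<open>Projections and their annihilators\<close>

context group_ring
begin

lemma A_induct [consumes 1, case_names L add scale]:
  assumes "x \<in> A"
    and L: "\<And>g. g \<in> carrier G \<Longrightarrow> P (L g)"
    and add: "\<And>x y. x \<in> A \<Longrightarrow> y \<in> A \<Longrightarrow> P x \<Longrightarrow> P y \<Longrightarrow> P (x + y)"
    and scale: "\<And>c x. x \<in> A \<Longrightarrow> P x \<Longrightarrow> P (sc c * x)"
  shows "P x"
proof -
  have "P 0" using scale[of "L \<one>" 0] L[of \<one>] by (simp add: sc_0)
  then have "P (\<Sum>g\<in>S. sc (u g) * L g)" if "S \<subseteq> carrier G" for S u
    using that
  proof (induction S rule: infinite_finite_induct)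
    case (insert g S)
    have "(\<Sum>h\<in>S. sc (u h) * L h) \<in> A" using insert.prems by (intro A_sum A_sc_mult A_L) auto
    then show ?case using insert by (auto intro!: add scale L)
  qed auto
  then show ?thesis using A_expand[OF assms(1)] by (metis order_refl)
qed

text \<open>Gram-Schmidt for the inner product \<open>tau (star x * y)\<close>. That
  \<open>y\<close> lies in the span of \<open>F\<close> is expressed as orthogonality to everything
  orthogonal to \<open>F\<close>.\<close>

lemma orthogonal_projection:
  assumes "finite F" "F \<subseteq> A" "u \<in> A"
  shows "\<exists>y\<in>A. (\<forall>f\<in>F. tau (star f * (u - y)) = 0) \<and>
    (\<forall>v\<in>A. (\<forall>f\<in>F. tau (star f * v) = 0) \<longrightarrow> tau (star y * v) = 0)"
  using assms
proof (induction F arbitrary: u rule: finite_induct)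
  case empty
  then show ?case by (auto intro!: bexI[of _ 0] simp: star_zero tau_zero)
next
  case (insert f F)
  have f: "f \<in> A" and F: "F \<subseteq> A" using insert.prems by auto
  obtain y where y: "y \<in> A" "\<And>f. f \<in> F \<Longrightarrow> tau (star f * (u - y)) = 0"
    "\<And>v. v \<in> A \<Longrightarrow> (\<forall>f\<in>F. tau (star f * v) = 0) \<Longrightarrow> tau (star y * v) = 0"
    using insert.IH[OF F insert.prems(2)] by blast
  obtain z where z: "z \<in> A" "\<And>f'. f' \<in> F \<Longrightarrow> tau (star f' * (f - z)) = 0"
    "\<And>v. v \<in> A \<Longrightarrow> (\<forall>f\<in>F. tau (star f * v) = 0) \<Longrightarrow> tau (star z * v) = 0"
    using insert.IH[OF F f] by blast
  \<comment> \<open>\<open>k\<close> is the part of \<open>f\<close> orthogonal to the earlier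
    vectors. If it vanishes, \<open>y\<close> already works; otherwise the component of
    \<open>u - y\<close> along \<open>k\<close> is added.\<close>
  define k where "k = f - z"
  have k: "k \<in> A" using f z by (simp add: k_def)
  have fk: "tau (star f * v) = tau (star k * v) + tau (star z * v)" if "v \<in> A" for v
    using f z that by (simp add: k_def star_diff left_diff_distrib tau_diff)
  show ?case
  proof (cases "k = 0")
    case True
    have "tau (star f * (u - y)) = 0"
      using fk[of "u - y"] y z(3)[of "u - y"] insert.prems True by (simp add: star_zero tau_zero)
    then show ?thesis using y by (intro bexI[of _ y]) auto
  next
    case False
    define c where "c = tau (star k * (u - y)) / tau (star k * k)"
    have c: "tau (star k * (u - y)) = c * tau (star k * k)"
      using False tau_star_mult_self[OF k] by (auto simp: c_def)
    define y' where "y' = y + sc c * k"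
    have y'A: "y' \<in> A" using y k by (simp add: y'_def)
    have inner: "tau (star x * (u - y')) = tau (star x * (u - y)) - c * tau (star x * k)" if "x \<in> A" for x
    proof -
      have "star x * (u - y') = star x * (u - y) - sc c * (star x * k)"
        by (simp add: y'_def algebra_simps sc_left_comm)
      then show ?thesis using that y k insert.prems by (simp add: tau_diff tau_sc)
    qed
    have F0: "tau (star x * (u - y')) = 0" if "x \<in> F" for x
      using inner[of x] y(2)[OF that] z(2)[OF that] F that by (auto simp: k_def)
    have "tau (star z * (u - y')) = 0" using z(3) F0 y'A insert.prems by simp
    moreover have "tau (star k * (u - y')) = 0" using inner[OF k] c by simp
    ultimately have "tau (star f * (u - y')) = 0" using fk y'A insert.prems by simp
    moreover have "tau (star y' * v) = 0" if v: "v \<in> A" "\<forall>f\<in>insert f F. tau (star f * v) = 0" for v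
    proof -
      have "tau (star k * v) = 0" using fk[OF v(1)] z(3)[OF v(1)] v(2) by simp
      moreover have "star y' * v = star y * v + sc (cnj c) * (star k * v)"
        using y k by (simp add: y'_def star_add star_sc_mult distrib_right mult.assoc)
      ultimately show ?thesis using y(3)[OF v(1)] v y k by (simp add: tau_add tau_sc)
    qed
    ultimately show ?thesis using y'A F0 by (intro bexI[of _ y']) auto
  qed
qed

lemma star_eq_self:
  assumes "x \<in> A" "star x * x = x"
  shows "star x = x"
  using star_mult[of "star x" x] assms by (simp add: star_star)

text \<open>The unit is the orthogonal projection \<open>e\<close> of 1 onto the ideal. With
  \<open>y = 1 - e\<close> orthogonal to \<open>V\<close> and \<open>x = star y * v\<close>,
  cyclicity of the trace rewrites \<open>tau (star x * x)\<close> as the inner product of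
  \<open>y\<close> with an element of \<open>V\<close>, so \<open>x = 0\<close> by
  faithfulness.\<close>

lemma ideal_unit:
  assumes F: "finite F" "F \<subseteq> A"
    and V: "V = {v \<in> A. \<forall>f\<in>F. tau (star f * v) = 0}"
    and left: "\<And>v t. v \<in> V \<Longrightarrow> t \<in> A \<Longrightarrow> t * v \<in> V"
    and right: "\<And>v t. v \<in> V \<Longrightarrow> t \<in> A \<Longrightarrow> v * t \<in> V"
  obtains e where "e \<in> V" "star e = e" "\<And>v. v \<in> V \<Longrightarrow> e * v = v" "\<And>v. v \<in> V \<Longrightarrow> v * e = v"
proof -
  obtain y where y: "y \<in> A" "\<forall>f\<in>F. tau (star f * (1 - y)) = 0"
    "\<forall>v\<in>A. (\<forall>f\<in>F. tau (star f * v) = 0) \<longrightarrow> tau (star y * v) = 0"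
    using orthogonal_projection[OF F A_one] by blast
  have yV: "tau (star y * v) = 0" if "v \<in> V" for v using y(3) that V by blast
  define e where "e = 1 - y"
  have eV: "e \<in> V" using y by (simp add: e_def V)
  have eA: "e \<in> A" using eV V by blast
  have sy: "star y = 1 - star e" using y by (simp add: e_def star_diff star_one)
  have l: "star e * v = v" if v: "v \<in> V" for v
  proof -
    have vA: "v \<in> A" using v V by blast
    let ?x = "star y * v"
    have "tau (star ?x * ?x) = tau (star y * (v * star ?x))"
      using vA y tau_comm[of "star ?x" "star y * v"] by (simp add: mult.assoc)
    also have "\<dots> = 0" using yV right[OF v] by simp
    finally have "?x = 0" using tau_star_mult_self vA by simp
    then show ?thesis by (simp add: sy algebra_simps)
  qed
  have r: "v * star e = v" if v: "v \<in> V" for v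
  proof -
    have vA: "v \<in> A" using v V by blast
    let ?x = "v * star y"
    have "tau (star ?x * ?x) = tau (star y * (star ?x * v))"
      using vA y tau_comm[of "star ?x * v" "star y"] by (simp add: mult.assoc)
    also have "\<dots> = 0" using yV left[OF v] by simp
    finally have "?x = 0" using tau_star_mult_self vA by simp
    then show ?thesis by (simp add: sy algebra_simps)
  qed
  have "star e = e" using star_eq_self[OF eA l[OF eV]] .
  then show thesis using that eV l r by simp
qed

section \<open>Annihilators of commutators and joins of projections\<close>

definition projn :: "'r \<Rightarrow> bool" where
  "projn p \<longleftrightarrow> p \<in> A \<and> p * p = p \<and> star p = p"

text \<open>The left annihilator of the two-sided ideal generated by the commutators with
  \<open>p\<close>; the middle factor \<open>t\<close> makes it a two-sided ideal.\<close>

definition ann :: "'r \<Rightarrow> 'r set" where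
  "ann p = {v \<in> A. \<forall>t\<in>A. \<forall>s\<in>A. v * t * (s * p - p * s) = 0}"

lemma annD: "v \<in> ann p \<Longrightarrow> t \<in> A \<Longrightarrow> s \<in> A \<Longrightarrow> v * t * (s * p - p * s) = 0"
  by (auto simp: ann_def)

lemma ann_left: "v \<in> ann p \<Longrightarrow> t \<in> A \<Longrightarrow> t * v \<in> ann p"
  by (auto simp: ann_def mult.assoc)

lemma ann_right: "v \<in> ann p \<Longrightarrow> t \<in> A \<Longrightarrow> v * t \<in> ann p"
  by (auto simp: ann_def mult.assoc[of v t])

text \<open>By cyclicity of the trace, orthogonality to \<open>star (L a * K (L s) * L b)\<close>
  for all \<open>b\<close> means \<open>v * L a * K (L s) = 0\<close>, so finitely many vectors cut
  out the annihilator. This is the form that \<open>ideal_unit\<close> takes.\<close>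

lemma ann_orthogonal:
  assumes p: "p \<in> A"
  obtains F where "finite F" "F \<subseteq> A" "ann p = {v \<in> A. \<forall>f\<in>F. tau (star f * v) = 0}"
proof -
  define K where "K = (\<lambda>s. s * p - p * s)"
  have K: "s \<in> A \<Longrightarrow> K s \<in> A" for s using p by (simp add: K_def)
  define F where "F = (\<lambda>(a, s, b). star (L a * K (L s) * L b)) ` (carrier G \<times> carrier G \<times> carrier G)"
  have swap: "tau (star (star (L a * K (L s) * L b)) * v) = tau (L b * (v * L a * K (L s)))"
    if "v \<in> A" "a \<in> carrier G" "s \<in> carrier G" "b \<in> carrier G" for v a s b
    using that K tau_comm[of "L a * K (L s)" "L b * v"] by (simp add: star_star mult.assoc)
  have "v \<in> ann p \<longleftrightarrow> (\<forall>f\<in>F. tau (star f * v) = 0)" if v: "v \<in> A" for v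
  proof
    assume "v \<in> ann p"
    then have "v * L a * K (L s) = 0" if "a \<in> carrier G" "s \<in> carrier G" for a s
      using that annD by (simp add: K_def)
    then show "\<forall>f\<in>F. tau (star f * v) = 0" using v by (auto simp: F_def swap tau_zero)
  next
    assume F0: "\<forall>f\<in>F. tau (star f * v) = 0"
    have base: "v * L a * K (L s) = 0" if as: "a \<in> carrier G" "s \<in> carrier G" for a s
    proof (rule A_eqI)
      fix g assume g: "g \<in> carrier G"
      have "tau (L (inv g) * (v * L a * K (L s))) = 0"
        using F0 swap[of v a s "inv g"] v as g by (force simp: F_def)
      then show "coef (v * L a * K (L s)) g = coef 0 g"
        using g v as K by (simp add: tau_L_mult coef_zero)
    qed (use v as K in auto)
    have "v * t * K s = 0" if "t \<in> A" "s \<in> A" for t s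
      using that(2)
    proof (induction s rule: A_induct)
      case (L g)
      show ?case using that(1)
      proof (induction t rule: A_induct)
        case (L a)
        then show ?case using base \<open>g \<in> carrier G\<close> by simp
      next
        case (add x y)
        then show ?case by (simp add: distrib_left distrib_right)
      next
        case (scale c x)
        then show ?case by (simp add: sc_left_comm mult.assoc)
      qed
    next
      case (add x y)
      have "K (x + y) = K x + K y" by (simp add: K_def algebra_simps)
      then show ?case using add by (simp add: distrib_left)
    next
      case (scale c x)
      have "K (sc c * x) = sc c * K x" by (simp add: K_def algebra_simps sc_left_comm[of p])
      then show ?case using scale by (simp add: sc_left_comm[of "v * t"])
    qed
    then show "v \<in> ann p" using v by (simp add: ann_def K_def)
  qed
  then have "ann p = {v \<in> A. \<forall>f\<in>F. tau (star f * v) = 0}" by (auto simp: ann_def)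
  moreover have "finite F" "F \<subseteq> A" using fin by (auto simp: F_def)
  ultimately show thesis using that by blast
qed

text \<open>The unit \<open>e\<close> of \<open>ann p\<close> is a central projection that kills all
  commutators with \<open>p\<close>. Hence \<open>p\<close> may be replaced by \<open>q\<close> on
  the summand belonging to \<open>e\<close> without losing any of them, and the commutators with
  \<open>q\<close> are gained there.\<close>

lemma projn_join:
  assumes p: "projn p" and q: "projn q"
  shows "\<exists>p'. projn p' \<and> ann p' \<subseteq> ann p \<inter> ann q"
proof -
  have pA: "p \<in> A" "p * p = p" "star p = p" and qA: "q \<in> A" "q * q = q" "star q = q"
    using p q by (auto simp: projn_def)
  obtain e where e: "e \<in> ann p" "star e = e" "\<And>v. v \<in> ann p \<Longrightarrow> e * v = v" "\<And>v. v \<in> ann p \<Longrightarrow> v * e = v"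
  proof -
    obtain F where F: "finite F" "F \<subseteq> A" "ann p = {v \<in> A. \<forall>f\<in>F. tau (star f * v) = 0}"
      using ann_orthogonal[OF pA(1)] .
    show thesis by (rule ideal_unit[OF F]) (auto intro: ann_left ann_right that)
  qed
  have eA: "e \<in> A" using e(1) by (simp add: ann_def)
  have ee: "e * e = e" using e by blast
  have central: "t * e = e * t" if "t \<in> A" for t
  proof -
    have "t * e = e * (t * e)" using e(3)[OF ann_left[OF e(1) that]] by simp
    also have "\<dots> = e * t" using e(4)[OF ann_right[OF e(1) that]] by (simp add: mult.assoc)
    finally show ?thesis .
  qed
  have ek: "e * (s * p - p * s) = 0" if "s \<in> A" for s
    using annD[OF e(1) A_one that] by simp
  define p' where "p' = (1 - e) * p + e * q"
  have eex: "e * (e * x) = e * x" for x by (simp add: ee flip: mult.assoc)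
  have cx: "t * (e * x) = e * (t * x)" if "t \<in> A" for t x
    using central[OF that] by (metis mult.assoc)
  note cs = central[OF pA(1)] central[OF qA(1)] cx[OF pA(1)] cx[OF qA(1)] ee eex
  have ppx: "p * (p * x) = p * x" "q * (q * x) = q * x" for x by (simp_all add: pA qA flip: mult.assoc)
  have "p' * p' = p'"
    unfolding p'_def by (simp add: algebra_simps cs pA qA)
  moreover have "star p' = p'"
    unfolding p'_def using pA qA eA e(2) by (simp add: star_add star_mult star_diff star_one cs algebra_simps)
  moreover have "p' \<in> A" using pA qA eA by (simp add: p'_def)
  ultimately have "projn p'" by (simp add: projn_def)
  moreover have "ann p' \<subseteq> ann p \<inter> ann q"
  proof
    fix v assume v: "v \<in> ann p'"
    have vA: "v \<in> A" using v by (simp add: ann_def)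
    have "v * t * (s * p - p * s) = 0" if ts: "t \<in> A" "s \<in> A" for t s
    proof -
      have "s * (1 - e) * p' - p' * (s * (1 - e)) = (s * p - p * s) - e * (s * p - p * s)"
        unfolding p'_def by (simp add: algebra_simps cs central[OF ts(2)] cx[OF ts(2)])
      then have "s * p - p * s = s * (1 - e) * p' - p' * (s * (1 - e))" using ek[OF ts(2)] by simp
      then show ?thesis using annD[OF v ts(1), of "s * (1 - e)"] ts eA by simp
    qed
    then have vp: "v \<in> ann p" using vA by (simp add: ann_def)
    \<comment> \<open>Since \<open>v\<close> already lies in \<open>ann p\<close>, the product
      \<open>v * t\<close> absorbs \<open>e\<close>, which removes the \<open>e\<close> in front of
      the commutator with \<open>q\<close>.\<close>
    have "v * t * (s * q - q * s) = 0" if ts: "t \<in> A" "s \<in> A" for t s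
    proof -
      have "s * e * p' - p' * (s * e) = e * (s * q - q * s)"
        unfolding p'_def by (simp add: algebra_simps cs central[OF ts(2)] cx[OF ts(2)])
      then have "v * t * e * (s * q - q * s) = 0"
        using annD[OF v ts(1), of "s * e"] ts eA by (simp add: mult.assoc)
      then show ?thesis using e(4)[OF ann_right[OF vp ts(1)]] by simp
    qed
    then show "v \<in> ann p \<inter> ann q" using vp vA by (simp add: ann_def)
  qed
  ultimately show ?thesis by blast
qed

lemma projn_one: "projn 1"
  by (simp add: projn_def star_one)

lemma projn_join_finite:
  assumes "finite Q" "\<forall>q\<in>Q. projn q"
  shows "\<exists>p. projn p \<and> (\<forall>q\<in>Q. ann p \<subseteq> ann q)"
  using assms
proof (induction Q rule: finite_induct)
  case empty
  then show ?case using projn_one by blast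
next
  case (insert q Q)
  then obtain p where "projn p" "\<forall>q\<in>Q. ann p \<subseteq> ann q" by auto
  then show ?case using projn_join[of p q] insert.prems by blast
qed

section \<open>Spectral projections of group elements\<close>

lemma sc_mult_power: "(sc c * x) ^ k = sc (c ^ k) * x ^ k"
  by (induction k) (simp_all add: sc_one sc_mult mult.assoc sc_left_comm[of x])

text \<open>The average over the powers of \<open>m\<close> is fixed by left multiplication with
  \<open>m\<close>, hence with \<open>star m\<close>, which is its inverse. So averaging it again,
  or averaging its adjoint powers, changes nothing: both \<open>?q * ?q\<close> and
  \<open>star ?q * ?q\<close> equal \<open>?q\<close>.\<close>

lemma average_projn:
  assumes m: "m \<in> A" "star m * m = 1" "m ^ n = 1" and n: "n > 0"
  shows "projn (sc (1 / of_nat n) * (\<Sum>k=1..n. m ^ k))" (is "projn ?q")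
proof -
  have pow: "m ^ k \<in> A" for k using m(1) by (induction k) auto
  have qA: "?q \<in> A" using pow by simp
  have shift: "(\<Sum>k=1..N. m ^ Suc k) + m ^ 1 = (\<Sum>k=1..N. m ^ k) + m ^ Suc N" for N
    by (induction N) (auto simp: algebra_simps)
  have "m * (\<Sum>k=1..n. m ^ k) = (\<Sum>k=1..n. m ^ k)"
    using shift[of n] m(3) by (simp add: sum_distrib_left)
  then have mq: "m * ?q = ?q" by (simp add: sc_left_comm[of m])
  have "m ^ k * y = y" if "m * y = y" for k y by (induction k) (use that in \<open>simp_all add: mult.assoc\<close>)
  then have mkq: "m ^ k * ?q = ?q" for k using mq by blast
  have "star m * ?q = star m * m * ?q" using mq by (simp add: mult.assoc)
  then have smq: "star m * ?q = ?q" using m(2) by simp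
  have smkq: "star (m ^ k) * ?q = ?q" for k
  proof (induction k)
    case (Suc k)
    have "star (m ^ Suc k) = star (m ^ k) * star m" using m(1) pow by (simp add: star_mult)
    then show ?case using Suc smq by (metis mult.assoc)
  qed (simp add: star_one)
  have avg: "sc (1 / of_nat n) * (\<Sum>k=1..n. ?q) = ?q"
  proof -
    have "(of_nat n :: 'r) = sc (of_nat n)" by (induction n) (auto simp: sc_0 sc_add sc_one)
    then have "sc (1 / of_nat n) * (of_nat n :: 'r) = sc (1 / of_nat n * of_nat n)"
      by (simp only: sc_mult)
    also have "\<dots> = 1" using n by (simp add: sc_one)
    finally have "sc (1 / of_nat n) * (of_nat n * y) = y" for y by (simp flip: mult.assoc)
    then show ?thesis by simp
  qed
  have "?q * ?q = sc (1 / of_nat n) * (\<Sum>k=1..n. m ^ k * ?q)"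
    by (simp add: mult.assoc sum_distrib_right)
  then have qq: "?q * ?q = ?q" using mkq avg by simp
  have star_sum: "star (\<Sum>k\<in>S. m ^ k) = (\<Sum>k\<in>S. star (m ^ k))" for S
    by (induction S rule: infinite_finite_induct) (auto simp: star_zero star_add pow)
  have "star ?q = sc (1 / of_nat n) * (\<Sum>k=1..n. star (m ^ k))"
    using pow by (simp add: star_sc_mult star_sum)
  then have "star ?q * ?q = sc (1 / of_nat n) * (\<Sum>k=1..n. star (m ^ k) * ?q)"
    by (simp add: mult.assoc sum_distrib_right)
  then have sqq: "star ?q * ?q = ?q" using smkq avg by simp
  show ?thesis using qA qq star_eq_self[OF qA sqq] by (simp add: projn_def)
qed

text \<open>\<open>L x\<close> is unitary and its n-th power is 1, n the group order.
  \<open>q j\<close> is its spectral projection at the root of unity \<open>w ^ j\<close>, and the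
  expansion is Fourier inversion on the cyclic group of order n.\<close>

lemma L_span_projn:
  assumes x: "x \<in> carrier G"
  shows "\<exists>q c. (\<forall>j < card (carrier G). projn (q j)) \<and> L x = (\<Sum>j < card (carrier G). sc (c j) * q j)"
proof -
  define n where "n = card (carrier G)"
  have n: "n > 0" using fin by (auto simp: n_def card_gt_0_iff)
  define w where "w = cis (2 * pi / n)"
  have wn: "w ^ n = 1" using n by (simp add: w_def DeMoivre)
  have wc: "w * cnj w = 1" by (simp add: w_def cis_mult cis_cnj)
  have Lpow: "L x ^ k = L (x [^] k)" for k
    by (induction k) (use x in \<open>auto simp: L_one L_mult power_Suc2 simp del: power_Suc\<close>)
  have Ln: "L x ^ n = 1" using pow_order_eq_1[OF x] by (simp add: Lpow n_def L_one Coset.order_def)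
  have uL: "L (inv x) * L x = 1" using x by (simp flip: L_mult add: L_one)
  define m where "m j = sc (cnj (w ^ j)) * L x" for j :: nat
  define q where "q j = sc (1 / of_nat n) * (\<Sum>k=1..n. m j ^ k)" for j
  have unit: "w ^ j * cnj (w ^ j) = 1" for j
    using wc by (simp flip: power_mult_distrib)
  have "projn (q j)" for j
    unfolding q_def
  proof (rule average_projn)
    show "m j \<in> A" using x by (simp add: m_def)
    have "star (m j) * m j = sc (w ^ j * cnj (w ^ j)) * (L (inv x) * L x)"
      using x by (simp add: m_def star_sc_mult star_L sc_mult mult.assoc sc_left_comm[of "L (inv x)"])
    then show "star (m j) * m j = 1" using unit uL by (simp add: sc_one)
    have "cnj (w ^ j) ^ n = cnj ((w ^ n) ^ j)" by (simp add: power_mult[symmetric] mult.commute)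
    then show "m j ^ n = 1" by (simp add: m_def sc_mult_power Ln sc_one wn)
  qed (use n in simp)
  moreover have "L x = (\<Sum>j<n. sc (w ^ j) * q j)"
  proof -
    \<comment> \<open>Orthogonality of characters, with \<open>z\<close> equal to \<open>w\<close>
      to the power \<open>1 - k\<close>. The exponents run over \<open>1..n\<close> and not from 0
      so that \<open>k = 1\<close> occurs even for the trivial group.\<close>
    have S: "(\<Sum>j<n. w ^ j * (1 / of_nat n * cnj (w ^ j) ^ k)) = (if k = 1 then 1 else 0)"
      if k: "k \<in> {1..n}" for k
    proof -
      define z where "z = w * cnj w ^ k"
      have wz: "w ^ j * (1 / of_nat n * cnj (w ^ j) ^ k) = z ^ j / of_nat n" for j
        by (simp add: z_def power_mult_distrib power_mult[symmetric] mult.commute)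
      have zn: "z ^ n = 1"
      proof -
        have "z ^ n = w ^ n * cnj (w ^ n) ^ k"
          by (simp add: z_def power_mult_distrib power_mult[symmetric] mult.commute)
        then show ?thesis by (simp add: wn)
      qed
      have z1: "z = 1 \<longleftrightarrow> k = 1"
      proof
        assume z: "z = 1"
        have "w ^ k = z * w ^ k" using z by simp
        also have "\<dots> = w * (w * cnj w) ^ k" by (simp add: z_def power_mult_distrib mult_ac)
        finally have "w * w ^ (k - 1) = w" using wc k by (cases k) auto
        then have "w ^ (k - 1) = 1" using wc by (metis mult_cancel_left mult_zero_left mult.right_neutral zero_neq_one)
        then have "cis (2 * pi * real (k - 1) / real n) = cis (2 * pi * real 0 / real n)"
          by (simp add: w_def DeMoivre mult.commute)
        then have "(\<lambda>k. cis (2 * pi * real k / real n)) (k - 1) = (\<lambda>k. cis (2 * pi * real k / real n)) 0" .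
        moreover have "inj_on (\<lambda>k. cis (2 * pi * real k / real n)) {..<n}"
          using bij_betw_roots_unity[OF n] by (rule bij_betw_imp_inj_on)
        ultimately have "k - 1 = 0" using k n by (meson inj_onD lessThan_iff diff_less less_le_trans zero_less_one atLeastAtMost_iff)
        then show "k = 1" using k by simp
      qed (simp add: z_def wc)
      show ?thesis
      proof (cases "k = 1")
        case True
        then show ?thesis unfolding wz using z1 n by simp
      next
        case False
        have "(\<Sum>j<n. z ^ j) = 0" using geometric_sum[of z n] z1 zn False by simp
        then show ?thesis unfolding wz using False by (simp add: sum_divide_distrib[symmetric])
      qed
    qed
    have "(\<Sum>j<n. sc (w ^ j) * q j) = (\<Sum>j<n. \<Sum>k=1..n. sc (w ^ j * (1 / of_nat n * cnj (w ^ j) ^ k)) * L x ^ k)"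
      unfolding q_def m_def sc_mult_power by (simp only: sum_distrib_left sc_mult mult.assoc)
    also have "\<dots> = (\<Sum>k=1..n. \<Sum>j<n. sc (w ^ j * (1 / of_nat n * cnj (w ^ j) ^ k)) * L x ^ k)"
      by (rule sum.swap)
    also have "\<dots> = (\<Sum>k=1..n. sc (if k = 1 then 1 else 0) * L x ^ k)"
      by (intro sum.cong refl) (simp only: S[symmetric] sc_sum sum_distrib_right)
    also have "\<dots> = (\<Sum>k=1..n. if k = 1 then L x else 0)"
      by (intro sum.cong) (auto simp: sc_0 sc_one)
    also have "\<dots> = L x" using n by simp
    finally show ?thesis by simp
  qed
  ultimately show ?thesis unfolding n_def by blast
qed

text \<open>By the spectral decomposition of each \<open>L x\<close> the projections span
  \<open>A\<close>. A claim linear in \<open>s\<close> about [s, p] is thereby reduced to a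
  projection \<open>s\<close>, for which the circle of unitaries is available.\<close>

lemma projn_induct [consumes 1, case_names projn add scale]:
  assumes "x \<in> A"
    and projn: "\<And>q. projn q \<Longrightarrow> P q"
    and add: "\<And>x y. x \<in> A \<Longrightarrow> y \<in> A \<Longrightarrow> P x \<Longrightarrow> P y \<Longrightarrow> P (x + y)"
    and scale: "\<And>c x. x \<in> A \<Longrightarrow> P x \<Longrightarrow> P (sc c * x)"
  shows "P x"
  using assms(1)
proof (induction x rule: A_induct)
  case (L g)
  then obtain q c and N :: nat where q: "\<forall>j<N. projn (q j)" "L g = (\<Sum>j<N. sc (c j) * q j)"
    using L_span_projn by blast
  have "P 0" using scale[OF A_one projn[OF projn_one], of 0] by (simp add: sc_0)
  moreover have "q j \<in> A" if "j < N" for j using q that by (simp add: projn_def)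
  ultimately have "P (\<Sum>j\<in>S. sc (c j) * q j)" if "S \<subseteq> {..<N}" for S
    using that
  proof (induction S rule: infinite_finite_induct)
    case (insert j S)
    have "(\<Sum>i\<in>S. sc (c i) * q i) \<in> A"
      using insert.prems \<open>\<And>j. j < N \<Longrightarrow> q j \<in> A\<close> by (intro A_sum A_sc_mult) auto
    moreover have "q j \<in> A" "P (q j)" using insert.prems q(1) projn by (auto simp: projn_def)
    ultimately show ?case using insert by (simp add: add scale)
  qed auto
  then show ?case using q(2) by simp
qed (auto intro: add scale)

end

section \<open>Generic projections\<close>

text \<open>The derived subgroup is normal with abelian quotient, so perfectness makes it the whole
  group.\<close>

lemma perfect_subgroup_eq:
  fixes G :: "'a monoid" (structure)
  assumes "group G" "perfect_group G" "subgroup H G"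
    and comm: "\<And>k l. k \<in> carrier G \<Longrightarrow> l \<in> carrier G \<Longrightarrow> k \<otimes> l \<otimes> inv k \<otimes> inv l \<in> H"
  shows "H = carrier G"
proof -
  interpret group G by fact
  have "derived G (carrier G) = carrier G"
    using assms(2) derived_self_is_normal derived_quot_is_comm_group unfolding perfect_group_def by blast
  moreover have "derived G (carrier G) \<subseteq> H"
    unfolding derived_def using comm by (intro generate_subgroup_incl assms(3)) auto
  ultimately show ?thesis using subgroup.subset[OF assms(3)] by blast
qed

context group_ring
begin

text \<open>For a perfect group, \<open>v * L g = v\<close> for all \<open>g\<close> describes the
  annihilator of the whole commutator ideal; commutators with \<open>p\<close> alone are required to
  cut it down this far.\<close>

definition full :: "'r \<Rightarrow> bool" where
  "full p \<longleftrightarrow> (\<forall>v\<in>ann p. \<forall>g\<in>carrier G. v * L g = v)"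

lemma exists_full_projn:
  assumes "perfect_group G"
  shows "\<exists>p. projn p \<and> full p"
proof -
  let ?n = "card (carrier G)"
  have "\<forall>x\<in>carrier G. \<exists>q c. (\<forall>j<?n. projn (q j)) \<and> L x = (\<Sum>j<?n. sc (c j) * q j)"
    using L_span_projn by blast
  then obtain q where q: "\<forall>x\<in>carrier G. \<exists>c. (\<forall>j<?n. projn (q x j)) \<and> L x = (\<Sum>j<?n. sc (c j) * q x j)"
    by metis
  \<comment> \<open>\<open>p\<close> dominates all spectral projections of all group elements. What
    annihilates its commutators therefore annihilates the commutators of the \<open>L l\<close>
    themselves, by linearity.\<close>
  have "\<exists>p. projn p \<and> (\<forall>r\<in>(\<Union>x\<in>carrier G. q x ` {..<?n}). ann p \<subseteq> ann r)"
    using q by (intro projn_join_finite) (auto simp: fin)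
  then obtain p where p: "projn p" "\<And>x j. x \<in> carrier G \<Longrightarrow> j < ?n \<Longrightarrow> ann p \<subseteq> ann (q x j)"
    by auto
  have "v * L g = v" if v: "v \<in> ann p" and g: "g \<in> carrier G" for v g
  proof -
    have comm: "v * (L k * L l) = v * (L l * L k)" if kl: "k \<in> carrier G" "l \<in> carrier G" for k l
    proof -
      obtain c where c: "L l = (\<Sum>j<?n. sc (c j) * q l j)" using q kl by blast
      have "v * (L k * (sc (c j) * q l j)) = v * (sc (c j) * q l j * L k)" if "j < ?n" for j
      proof -
        have "v * 1 * (L k * q l j - q l j * L k) = 0"
          using p(2)[OF kl(2) that] v kl by (intro annD) auto
        then show ?thesis
          by (simp add: sc_left_comm[of v] sc_left_comm[of "L k"] mult.assoc right_diff_distrib)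
      qed
      then show ?thesis by (simp add: c sum_distrib_left sum_distrib_right)
    qed
    have "v \<in> A" using v by (simp add: ann_def)
    define H where "H = {g \<in> carrier G. v * L g = v}"
    have "subgroup H G"
    proof
      fix x y assume "x \<in> H" "y \<in> H"
      then show "x \<otimes> y \<in> H" by (auto simp: H_def L_mult simp flip: mult.assoc)
    next
      fix x assume x: "x \<in> H"
      then have "v * L (inv x) = v * L x * L (inv x)" by (simp add: H_def)
      also have "\<dots> = v * (L x * L (inv x))" by (simp add: mult.assoc)
      also have "\<dots> = v" using x by (simp add: H_def L_one flip: L_mult)
      finally show "inv x \<in> H" using x by (simp add: H_def)
    qed (auto simp: H_def L_one)
    moreover have "k \<otimes> l \<otimes> inv k \<otimes> inv l \<in> H" if kl: "k \<in> carrier G" "l \<in> carrier G" for k l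
    proof -
      have "v * L (k \<otimes> l \<otimes> inv k \<otimes> inv l) = v * (L k * L l) * L (inv k \<otimes> inv l)"
        using kl by (simp add: m_assoc flip: L_mult) (simp add: mult.assoc L_mult)
      also have "\<dots> = v * (L l * L k) * L (inv k \<otimes> inv l)" using comm[OF kl] by simp
      also have "\<dots> = v * L ((l \<otimes> k) \<otimes> (inv k \<otimes> inv l))"
        using kl by (simp add: L_mult mult.assoc)
      also have "(l \<otimes> k) \<otimes> (inv k \<otimes> inv l) = \<one>"
        using kl by (simp flip: inv_mult_group)
      finally show ?thesis using kl by (simp add: H_def L_one)
    qed
    ultimately have "H = carrier G" using perfect_subgroup_eq[OF is_group assms] by blast
    then show ?thesis using g by (auto simp: H_def)
  qed
  then show ?thesis using p(1) by (auto simp: full_def)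
qed

text \<open>For \<open>w\<close> on the unit circle this is \<open>u * p * star u\<close> with the unitary
  \<open>u = 1 + sc (w - 1) * r\<close>, written as a Laurent polynomial in \<open>w\<close>.\<close>

definition rot :: "complex \<Rightarrow> 'r \<Rightarrow> 'r \<Rightarrow> 'r" where
  "rot w r p = (p - r * p * (1 - r) - (1 - r) * p * r) + sc w * (r * p * (1 - r)) + sc (cnj w) * ((1 - r) * p * r)"

lemma rot_one: "rot 1 r p = p"
  by (simp add: rot_def sc_one)

lemma rot_unitary:
  assumes r: "projn r" and w: "cmod w = 1"
  obtains u v where "u \<in> A" "v \<in> A" "star u = v" "v * u = 1" "u * v = 1" "\<forall>p. rot w r p = u * p * v"
proof -
  have rA: "r \<in> A" "r * r = r" "star r = r" using r by (auto simp: projn_def)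
  have rr: "r * (r * x) = r * x" for x by (simp add: rA flip: mult.assoc)
  have "w * cnj w = 1" using w by (simp add: complex_norm_square[symmetric])
  then have WW: "sc w * sc (cnj w) = 1" "sc (cnj w) * sc w = 1"
    by (simp_all add: sc_one mult.commute flip: sc_mult)
  have WWx: "sc w * (sc (cnj w) * x) = x" "sc (cnj w) * (sc w * x) = x" for x
    by (simp_all add: WW flip: mult.assoc)
  note rW = sc_comm[of _ r, symmetric] sc_left_comm[of r]
  let ?u = "1 + (sc w - 1) * r" and ?v = "1 + (sc (cnj w) - 1) * r"
  have uA: "?u \<in> A" "?v \<in> A" using rA by auto
  have "star ?u = ?v"
    using rA star_sc_mult[of r "w - 1"] by (simp add: star_add star_one sc_diff sc_one)
  moreover have "?v * ?u = 1" "?u * ?v = 1"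
    by (simp_all add: algebra_simps rA rr rW WW WWx)
  moreover have "rot w r p = ?u * p * ?v" for p
    by (simp add: rot_def algebra_simps rA rr rW WW WWx sc_comm[of _ p, symmetric] sc_left_comm[of p])
  ultimately show thesis using that uA by blast
qed

lemma projn_rot:
  assumes "projn p" "projn r" "cmod w = 1"
  shows "projn (rot w r p)"
proof -
  obtain u v where u: "u \<in> A" "v \<in> A" "star u = v" "v * u = 1" "u * v = 1" "\<forall>p. rot w r p = u * p * v"
    using rot_unitary[OF assms(2,3)] .
  have p: "p \<in> A" "p * p = p" "star p = p" using assms(1) by (auto simp: projn_def)
  have "star v = u" using u star_star by blast
  have vux: "v * (u * x) = x" and ppx: "p * (p * x) = p * x" for x
    by (simp_all add: u p flip: mult.assoc)
  show ?thesis
    using u p \<open>star v = u\<close> by (simp add: projn_def star_mult mult.assoc vux ppx)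
qed

text \<open>Conjugation by \<open>u\<close> carries commutators with \<open>p\<close> to commutators
  with the rotated projection, and the middle factor in \<open>ann\<close> absorbs the leftover
  \<open>v\<close>; hence the annihilator does not grow.\<close>

lemma full_rot:
  assumes "p \<in> A" "full p" "projn r" "cmod w = 1"
  shows "full (rot w r p)"
proof -
  obtain u v where u: "u \<in> A" "v \<in> A" "star u = v" "v * u = 1" "u * v = 1" "\<forall>p. rot w r p = u * p * v"
    using rot_unitary[OF assms(3,4)] .
  have vux: "v * (u * x) = x" for x by (simp add: u flip: mult.assoc)
  have "x \<in> ann p" if x: "x \<in> ann (rot w r p)" for x
  proof -
    have "x * t * (s * p - p * s) = 0" if ts: "t \<in> A" "s \<in> A" for t s
    proof -
      have "x * (t * v) * ((u * s * v) * rot w r p - rot w r p * (u * s * v)) * u = 0"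
        using annD[OF x, of "t * v" "u * s * v"] ts u by simp
      also have "x * (t * v) * ((u * s * v) * rot w r p - rot w r p * (u * s * v)) * u
          = x * t * (s * p - p * s)"
        by (simp add: u(4,6) vux algebra_simps)
      finally show ?thesis .
    qed
    then show ?thesis using x by (simp add: ann_def)
  qed
  then show ?thesis using assms(2) by (auto simp: full_def)
qed

section \<open>Maximal separation of coefficients\<close>

definition separated :: "'r \<Rightarrow> ('a \<times> 'a) set" where
  "separated p = {(g, h) \<in> carrier G \<times> carrier G. coef p g \<noteq> coef p h}"

definition generic :: "'r \<Rightarrow> bool" where
  "generic p \<longleftrightarrow> projn p \<and> full p \<and>
     (\<forall>q. projn q \<longrightarrow> full q \<longrightarrow> card (separated q) \<le> card (separated p))"

lemma finite_separated: "finite (separated p)"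
  by (rule finite_subset[of _ "carrier G \<times> carrier G"]) (auto simp: separated_def fin)

lemma exists_generic:
  assumes "perfect_group G"
  shows "\<exists>p. generic p"
proof -
  obtain p0 where p0: "projn p0 \<and> full p0" using exists_full_projn[OF assms] by blast
  have "card (separated p) \<le> card (carrier G \<times> carrier G)" for p
    by (rule card_mono) (auto simp: separated_def fin)
  then have "\<exists>p. (projn p \<and> full p) \<and> (\<forall>q. projn q \<and> full q \<longrightarrow> card (separated q) \<le> card (separated p))"
    by (intro ex_has_greatest_nat[of _ p0 _ "Suc (card (carrier G \<times> carrier G))"] p0) (auto simp: less_Suc_eq_le)
  then show ?thesis by (auto simp: generic_def)
qed

end

lemma infinite_unit_circle: "infinite {w. cmod w = 1}"
proof
  assume f: "finite {w. cmod w = 1}"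
  define n where "n = Suc (card {w. cmod w = 1})"
  have "cmod w = 1" if "w ^ n = 1" for w
    using power_eq_1_iff[OF that] by (simp add: n_def)
  then have "card {w :: complex. w ^ n = 1} \<le> card {w. cmod w = 1}"
    by (intro card_mono f) auto
  then show False using card_roots_unity_eq[of n] by (simp add: n_def)
qed

text \<open>On the circle, multiplication by \<open>w\<close> turns the expression into the
  polynomial with coefficients \<open>c\<close>, \<open>a\<close>, \<open>b\<close> in ascending
  degree.\<close>

lemma finite_laurent_zeros:
  assumes "\<not> (a = 0 \<and> b = 0 \<and> c = 0)"
  shows "finite {w. cmod w = 1 \<and> a + w * b + cnj w * c = 0}"
proof (rule finite_subset)
  show "{w. cmod w = 1 \<and> a + w * b + cnj w * c = 0} \<subseteq> {w. poly [:c, a, b:] w = 0}"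
  proof safe
    fix w assume w: "cmod w = 1" "a + w * b + cnj w * c = 0"
    have "w * cnj w = 1" using w(1) by (simp add: complex_norm_square[symmetric])
    then have "w * (a + w * b + cnj w * c) = poly [:c, a, b:] w" by (simp add: algebra_simps)
    then show "poly [:c, a, b:] w = 0" using w(2) by simp
  qed
  show "finite {w. poly [:c, a, b:] w = 0}"
    using assms by (intro poly_roots_finite) auto
qed

section \<open>Separation of coefficients\<close>

context group_ring
begin

lemma coef_rot:
  assumes "p \<in> A" "r \<in> A" "g \<in> carrier G"
  shows "coef (rot w r p) g = coef (p - r * p * (1 - r) - (1 - r) * p * r) g
    + w * coef (r * p * (1 - r)) g + cnj w * coef ((1 - r) * p * r) g"
  using assms by (simp add: rot_def coef_add coef_sc)

text \<open>At \<open>w = 1\<close> the rotation is \<open>p\<close> itself, so for a separated pair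
  the Laurent polynomial of the coefficient difference is not identically zero; \<open>E\<close>
  collects the zeros. Outside \<open>E\<close> no separated pair is lost, and maximality of
  \<open>p\<close> prevents any gain.\<close>

lemma generic_rot:
  assumes p: "generic p" and r: "projn r"
  shows "\<exists>E. finite E \<and> (\<forall>w. cmod w = 1 \<longrightarrow> w \<notin> E \<longrightarrow>
    generic (rot w r p) \<and> separated (rot w r p) = separated p)"
proof -
  have pA: "p \<in> A" and rA: "r \<in> A" and pp: "projn p" "full p"
    using p r by (auto simp: generic_def projn_def)
  define d where "d x = (\<lambda>(g, h). coef x g - coef x h)" for x
  define E where "E = (\<Union>k\<in>separated p. {w. cmod w = 1 \<and> d (rot w r p) k = 0})"
  have "finite {w. cmod w = 1 \<and> d (rot w r p) k = 0}" if k: "k \<in> separated p" for k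
  proof -
    let ?a = "d (p - r * p * (1 - r) - (1 - r) * p * r) k"
    let ?b = "d (r * p * (1 - r)) k" and ?c = "d ((1 - r) * p * r) k"
    have d: "d (rot w r p) k = ?a + w * ?b + cnj w * ?c" for w
      using k pA rA by (auto simp: separated_def d_def coef_rot algebra_simps)
    have "d (rot 1 r p) k \<noteq> 0" using k by (auto simp: rot_one separated_def d_def)
    then have "\<not> (?a = 0 \<and> ?b = 0 \<and> ?c = 0)" using d[of 1] by auto
    then show ?thesis unfolding d by (rule finite_laurent_zeros)
  qed
  then have "finite E" by (simp add: E_def finite_separated)
  moreover have "generic (rot w r p) \<and> separated (rot w r p) = separated p"
    if w: "cmod w = 1" "w \<notin> E" for w
  proof -
    have rot: "projn (rot w r p)" "full (rot w r p)"
      using projn_rot full_rot pp pA r w by auto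
    have "separated p \<subseteq> separated (rot w r p)"
      using w by (auto simp: E_def separated_def d_def)
    moreover have "card (separated (rot w r p)) \<le> card (separated p)"
      using p rot by (simp add: generic_def)
    ultimately have "separated (rot w r p) = separated p"
      using card_seteq[OF finite_separated] by metis
    then show ?thesis using p rot by (auto simp: generic_def)
  qed
  ultimately show ?thesis by blast
qed

text \<open>Two coefficients of a generic projection that coincide keep coinciding along almost
  all of its unitary conjugates, so every Laurent coefficient in \<open>w\<close> vanishes.\<close>

lemma generic_unseparated:
  assumes p: "generic p" and g: "g \<in> carrier G" and h: "h \<in> carrier G"
    and eq: "coef p g = coef p h" and s: "s \<in> A"
  shows "coef (s * p - p * s) g = coef (s * p - p * s) h"
  using s
proof (induction s rule: projn_induct)
  case (projn r)
  have pA: "p \<in> A" and rA: "r \<in> A" using p projn by (auto simp: generic_def projn_def)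
  let ?a = "coef (p - r * p * (1 - r) - (1 - r) * p * r) g - coef (p - r * p * (1 - r) - (1 - r) * p * r) h"
  let ?b = "coef (r * p * (1 - r)) g - coef (r * p * (1 - r)) h"
  let ?c = "coef ((1 - r) * p * r) g - coef ((1 - r) * p * r) h"
  obtain E where E: "finite E" "\<And>w. cmod w = 1 \<Longrightarrow> w \<notin> E \<Longrightarrow> separated (rot w r p) = separated p"
    using generic_rot[OF p projn] by blast
  have "?a + w * ?b + cnj w * ?c = 0" if "cmod w = 1" "w \<notin> E" for w
  proof -
    have "(g, h) \<notin> separated (rot w r p)" using E(2)[OF that] eq by (simp add: separated_def)
    then show ?thesis using g h pA rA by (simp add: separated_def coef_rot algebra_simps)
  qed
  then have "{w. cmod w = 1} - E \<subseteq> {w. cmod w = 1 \<and> ?a + w * ?b + cnj w * ?c = 0}" by blast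
  then have "infinite {w. cmod w = 1 \<and> ?a + w * ?b + cnj w * ?c = 0}"
    using infinite_unit_circle E(1) by (meson Diff_infinite_finite finite_subset)
  then have "?b = 0 \<and> ?c = 0" using finite_laurent_zeros by blast
  \<comment> \<open>The commutator is the difference of the two outer Laurent coefficients, which
    have just been shown to agree at \<open>g\<close> and \<open>h\<close>.\<close>
  moreover have "r * p - p * r = r * p * (1 - r) - (1 - r) * p * r" by (simp add: algebra_simps)
  ultimately show ?case using pA rA g h by (simp add: coef_diff del: A_diff) (simp add: coef_diff)
next
  case (add x y)
  have pA: "p \<in> A" using p by (auto simp: generic_def projn_def)
  have "(x + y) * p - p * (x + y) = (x * p - p * x) + (y * p - p * y)" by (simp add: algebra_simps)
  then show ?case using add pA g h by (simp add: coef_add)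
next
  case (scale c x)
  have pA: "p \<in> A" using p by (auto simp: generic_def projn_def)
  have "sc c * x * p - p * (sc c * x) = sc c * (x * p - p * x)"
    by (simp add: algebra_simps sc_left_comm[of p])
  then show ?case using scale pA g h by (simp add: coef_sc)
qed

section \<open>Commutation forced by equal coefficients\<close>

lemma tau_commutator:
  assumes "w \<in> A" "s \<in> A" "p \<in> A"
  shows "tau (w * (s * p - p * s)) = tau (s * (p * w - w * p))"
  using assms tau_comm[of w "s * p"] tau_comm[of "w * p" s]
  by (simp add: right_diff_distrib tau_diff mult.assoc)

text \<open>The inverses come from \<open>coef x g = tau (L (inv g) * x)\<close>: pairing [s, p]
  with \<open>?w\<close> gives its coefficient difference, which is 0. Moving the commutator across
  the trace yields \<open>tau (s * (p * ?w - ?w * p)) = 0\<close> for all \<open>s\<close>, and the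
  trace form is nondegenerate.\<close>

lemma generic_commute:
  assumes p: "generic p" and g: "g \<in> carrier G" and h: "h \<in> carrier G"
    and eq: "coef p g = coef p h"
  shows "(L (inv g) - L (inv h)) * p = p * (L (inv g) - L (inv h))" (is "?w * p = p * ?w")
proof -
  have pA: "p \<in> A" using p by (auto simp: generic_def projn_def)
  have wA: "?w \<in> A" using g h by simp
  have "tau (s * (p * ?w - ?w * p)) = 0" if s: "s \<in> A" for s
  proof -
    have "tau (?w * (s * p - p * s)) = coef (s * p - p * s) g - coef (s * p - p * s) h"
      using g h s pA by (simp add: left_diff_distrib tau_diff tau_L_mult)
    then have "tau (?w * (s * p - p * s)) = 0"
      using generic_unseparated[OF p g h eq s] by simp
    then show ?thesis using tau_commutator[OF wA s pA] by simp
  qed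
  then have "p * ?w - ?w * p = 0" using tau_nondeg pA wA by (meson A_diff A_mult)
  then show ?thesis by simp
qed

text \<open>\<open>W\<close> depends only on \<open>g\<close> and \<open>h\<close>, while outside a
  finite set the rotated projections are again generic with the same separated pairs. So
  \<open>W\<close> commutes with almost the whole circle, hence with the outer Laurent coefficients
  \<open>b\<close> and \<open>c\<close>, whose difference is [r, p].\<close>

lemma generic_commute_commutator:
  assumes p: "generic p" and g: "g \<in> carrier G" and h: "h \<in> carrier G"
    and eq: "coef p g = coef p h" and s: "s \<in> A"
  shows "(L (inv g) - L (inv h)) * (s * p - p * s) = (s * p - p * s) * (L (inv g) - L (inv h))"
proof -
  have pA: "p \<in> A" using p by (auto simp: generic_def projn_def)
  define W where "W = L (inv g) - L (inv h)"
  have wA: "W \<in> A" using g h by (simp add: W_def)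
  have "W * (s * p - p * s) = (s * p - p * s) * W"
    using s
  proof (induction s rule: projn_induct)
    case (projn r)
    have rA: "r \<in> A" using projn by (auto simp: projn_def)
    define a where "a = p - r * p * (1 - r) - (1 - r) * p * r"
    define b where "b = r * p * (1 - r)"
    define c where "c = (1 - r) * p * r"
    have rot: "rot w r p = a + sc w * b + sc (cnj w) * c" for w
      by (simp add: rot_def a_def b_def c_def)
    have abc: "a \<in> A" "b \<in> A" "c \<in> A" using pA rA by (auto simp: a_def b_def c_def)
    obtain E where E: "finite E" "\<And>w. cmod w = 1 \<Longrightarrow> w \<notin> E \<Longrightarrow>
        generic (rot w r p) \<and> separated (rot w r p) = separated p"
      using generic_rot[OF p projn] by blast
    have "W * b - b * W = 0 \<and> W * c - c * W = 0"
    proof -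
      have "coef (W * b - b * W) k = 0 \<and> coef (W * c - c * W) k = 0" if k: "k \<in> carrier G" for k
      proof -
        let ?C = "\<lambda>x. coef (W * x - x * W) k"
        have "?C a + w * ?C b + cnj w * ?C c = 0" if w: "cmod w = 1" "w \<notin> E" for w
        proof -
          have "coef (rot w r p) g = coef (rot w r p) h"
            using E(2)[OF w] eq g h by (auto simp: separated_def)
          then have "W * rot w r p = rot w r p * W"
            using generic_commute[of "rot w r p"] E(2)[OF w] g h by (simp add: W_def)
          moreover have "W * rot w r p - rot w r p * W =
              (W * a - a * W) + sc w * (W * b - b * W) + sc (cnj w) * (W * c - c * W)"
            unfolding rot by (simp add: algebra_simps sc_left_comm[of W])
          ultimately have "coef ((W * a - a * W) + sc w * (W * b - b * W) + sc (cnj w) * (W * c - c * W)) k = 0"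
            using k by (simp add: coef_zero)
          then show ?thesis using k abc wA by (simp add: coef_add coef_sc)
        qed
        then have "{w. cmod w = 1} - E \<subseteq> {w. cmod w = 1 \<and> ?C a + w * ?C b + cnj w * ?C c = 0}" by blast
        then have "infinite {w. cmod w = 1 \<and> ?C a + w * ?C b + cnj w * ?C c = 0}"
          using infinite_unit_circle E(1) by (meson Diff_infinite_finite finite_subset)
        then show ?thesis using finite_laurent_zeros by blast
      qed
      then show ?thesis by (intro conjI A_eqI) (use abc wA coef_zero in auto)
    qed
    moreover have diff: "r * p - p * r = b - c" by (simp add: b_def c_def algebra_simps)
    ultimately show ?case unfolding diff by (simp add: right_diff_distrib left_diff_distrib)
  next
    case (add x y)
    have diff: "(x + y) * p - p * (x + y) = (x * p - p * x) + (y * p - p * y)" by (simp add: algebra_simps)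
    show ?case unfolding diff distrib_left[of W] distrib_right[of _ _ W] using add by simp
  next
    case (scale c x)
    have "sc c * x * p - p * (sc c * x) = sc c * (x * p - p * x)"
      by (simp add: algebra_simps sc_left_comm[of p])
    then show ?case using scale by (simp add: sc_left_comm[of W] mult.assoc)
  qed
  then show ?thesis by (simp add: W_def)
qed

lemma commute_mult: "w * x = x * w \<Longrightarrow> w * y = y * w \<Longrightarrow> w * (x * y) = (x * y) * w"
  for w :: 'r
  by (metis mult.assoc)

text \<open>The commutant of \<open>w\<close> contains \<open>p\<close> and all commutators with \<open>p\<close>; being multiplicatively
  closed it contains \<open>(1 - p) * s * p\<close> and \<open>p * s * (1 - p)\<close>, hence the left ideal
  generated by these.\<close>

lemma commute_left_ideal:
  fixes w :: 'r
  assumes pp: "p * p = p" and pA: "p \<in> A" and wp: "w * p = p * w"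
    and wk: "\<And>s. s \<in> A \<Longrightarrow> w * (s * p - p * s) = (s * p - p * s) * w"
    and t: "t \<in> A" and s: "s \<in> A"
  shows "w * (t * (s * p - p * s)) = (t * (s * p - p * s)) * w"
proof -
  have ppx: "p * (p * x) = p * x" for x by (simp add: pp flip: mult.assoc)
  have lower: "w * ((1 - p) * x * p) = ((1 - p) * x * p) * w" if "x \<in> A" for x
  proof -
    have "(1 - p) * x * p = (x * p - p * x) * p" by (simp add: algebra_simps pp)
    then show ?thesis using commute_mult[OF wk[OF that] wp] by simp
  qed
  have upper: "w * (p * x * (1 - p)) = (p * x * (1 - p)) * w" if "x \<in> A" for x
  proof -
    have "p * x * (1 - p) = - (p * (x * p - p * x))" by (simp add: algebra_simps ppx)
    then show ?thesis using commute_mult[OF wp wk[OF that]] by simp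
  qed
  \<comment> \<open>Block decomposition with respect to \<open>p\<close> and \<open>1 - p\<close>.
    Diagonal blocks of \<open>t\<close> are absorbed into the off-diagonal corner that they
    multiply; off-diagonal blocks of \<open>t\<close> give products of two corners.\<close>
  have "t * (s * p - p * s) =
      (p * t * (1 - p)) * ((1 - p) * s * p) + (1 - p) * (t * (1 - p) * s) * p
      - (p * (t * p * s) * (1 - p) + ((1 - p) * t * p) * (p * s * (1 - p)))"
    by (simp add: algebra_simps pp ppx)
  moreover have "w * ((p * t * (1 - p)) * ((1 - p) * s * p)) = ((p * t * (1 - p)) * ((1 - p) * s * p)) * w"
    using lower[OF s] upper[OF t] by (rule commute_mult[rotated])
  moreover have "w * (((1 - p) * t * p) * (p * s * (1 - p))) = (((1 - p) * t * p) * (p * s * (1 - p))) * w"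
    using lower[OF t] upper[OF s] by (rule commute_mult)
  moreover have "w * ((1 - p) * (t * (1 - p) * s) * p) = ((1 - p) * (t * (1 - p) * s) * p) * w"
    using lower t s pA by simp
  moreover have "w * (p * (t * p * s) * (1 - p)) = (p * (t * p * s) * (1 - p)) * w"
    using upper t s pA by simp
  ultimately show ?thesis by (simp only: distrib_left distrib_right left_diff_distrib right_diff_distrib)
qed

lemma generic_separates:
  assumes p: "generic p" and g: "g \<in> carrier G" and h: "h \<in> carrier G" and gh: "g \<noteq> h"
    and k: "k \<in> carrier G" "k \<otimes> g \<noteq> g \<otimes> k"
  shows "coef p g \<noteq> coef p h"
proof
  assume eq: "coef p g = coef p h"
  have pA: "p \<in> A" and pp: "p * p = p" and full: "full p" using p by (auto simp: generic_def projn_def)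
  define W where "W = L (inv g) - L (inv h)"
  have wA: "W \<in> A" using g h by (simp add: W_def)
  have wp: "W * p = p * W" using generic_commute[OF p g h eq] by (simp add: W_def)
  have wk: "W * (s * p - p * s) = (s * p - p * s) * W" if "s \<in> A" for s
    using generic_commute_commutator[OF p g h eq that] by (simp add: W_def)
  define v where "v = W * L k - L k * W"
  have vA: "v \<in> A" using wA k by (simp add: v_def)
  \<comment> \<open>\<open>W\<close> commutes with an element of the left ideal and also with its
    multiple by \<open>L k\<close>; subtracting shows that the commutator of \<open>W\<close> and
    \<open>L k\<close> kills that element.\<close>
  have "v * t * (s * p - p * s) = 0" if ts: "t \<in> A" "s \<in> A" for t s
  proof -
    have 1: "W * (t * (s * p - p * s)) = (t * (s * p - p * s)) * W"
      by (rule commute_left_ideal[OF pp pA wp wk ts])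
    have 2: "W * ((L k * t) * (s * p - p * s)) = ((L k * t) * (s * p - p * s)) * W"
      by (rule commute_left_ideal[OF pp pA wp wk]) (use ts k in auto)
    have "v * t * (s * p - p * s) = W * ((L k * t) * (s * p - p * s)) - L k * (W * (t * (s * p - p * s)))"
      by (simp only: v_def left_diff_distrib mult.assoc)
    also have "\<dots> = 0" unfolding 1 2 by (simp only: mult.assoc diff_self)
    finally show ?thesis .
  qed
  then have vann: "v \<in> ann p" using vA by (simp add: ann_def)
  have "tau (W * L k) = tau (L k * W)" using wA k by (intro tau_comm) auto
  then have tv: "tau v = 0" using wA k by (simp add: v_def tau_diff)
  \<comment> \<open>Right invariance makes all coefficients of \<open>v\<close> equal to the one at
    the neutral element, which is the trace of a commutator.\<close>
  have v0: "coef v x = 0" if x: "x \<in> carrier G" for x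
  proof -
    have "coef v x = tau (L (inv x) * v)" using vA x by (simp add: tau_L_mult)
    also have "\<dots> = tau (v * L (inv x))" using vA x by (intro tau_comm) auto
    also have "v * L (inv x) = v" using full vann x by (simp add: full_def)
    finally show ?thesis using tv by simp
  qed
  have "v = L (inv g \<otimes> k) - L (inv h \<otimes> k) - L (k \<otimes> inv g) + L (k \<otimes> inv h)"
    using g h k by (simp add: v_def W_def L_mult algebra_simps)
  \<comment> \<open>The two negative terms do not meet \<open>inv g \<otimes> k\<close>, since
    \<open>g\<close> differs from \<open>h\<close> and does not commute with \<open>k\<close>; the
    last term can only add. The coefficient is thus 1 or 2.\<close>
  then have "coef v (inv g \<otimes> k) = 1 - (if inv g \<otimes> k = inv h \<otimes> k then 1 else 0)
      - (if inv g \<otimes> k = k \<otimes> inv g then 1 else 0) + (if inv g \<otimes> k = k \<otimes> inv h then 1 else 0)"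
    using g h k by (simp add: coef_add coef_diff coef_L)
  moreover have "inv g \<otimes> k \<noteq> inv h \<otimes> k" using g h k gh by (metis inv_closed inv_inv r_cancel)
  moreover have "inv g \<otimes> k \<noteq> k \<otimes> inv g"
  proof
    assume "inv g \<otimes> k = k \<otimes> inv g"
    then have "g \<otimes> (inv g \<otimes> k) \<otimes> g = g \<otimes> (k \<otimes> inv g) \<otimes> g" by simp
    moreover have "g \<otimes> (inv g \<otimes> k) = k" using g k by (simp flip: m_assoc)
    moreover have "g \<otimes> (k \<otimes> inv g) \<otimes> g = g \<otimes> k" using g k by (simp add: m_assoc)
    ultimately show False using k by simp
  qed
  ultimately have "coef v (inv g \<otimes> k) \<noteq> 0" by auto
  then show False using v0 g k by simp
qed

end

section \<open>The diagonal quantum graph and its classical automorphisms\<close>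

lemma exists_separating_projection:
  fixes G :: "'a monoid" (structure)
  assumes "group G" "finite (carrier G)" "perfect_group G"
  obtains q :: "'a \<Rightarrow> complex" where
    "\<And>l. l \<in> carrier G \<Longrightarrow> (\<Sum>h\<in>carrier G. q h * q (inv h \<otimes> l)) = q l"
    "\<And>g. g \<in> carrier G \<Longrightarrow> cnj (q (inv g)) = q g"
    "\<And>g h k. g \<in> carrier G \<Longrightarrow> h \<in> carrier G \<Longrightarrow> k \<in> carrier G \<Longrightarrow> k \<otimes> g \<noteq> g \<otimes> k \<Longrightarrow> g \<noteq> h \<Longrightarrow> q g \<noteq> q h"
proof -
  interpret group_ring G "cend_transl G" cend_scalar by (rule group_ring_cend) fact+
  obtain p where p: "generic p" using exists_generic[OF assms(3)] by blast
  have pA: "p \<in> A" "p * p = p" "star p = p" using p by (auto simp: generic_def projn_def)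
  show thesis
  proof
    fix l assume "l \<in> carrier G"
    then show "(\<Sum>h\<in>carrier G. coef p h * coef p (inv h \<otimes> l)) = coef p l"
      using coef_mult[of p p l] pA by simp
  next
    fix g assume "g \<in> carrier G"
    then show "cnj (coef p (inv g)) = coef p g" using coef_star[of g p] pA by simp
  next
    fix g h k assume "g \<in> carrier G" "h \<in> carrier G" "k \<in> carrier G" "k \<otimes> g \<noteq> g \<otimes> k" "g \<noteq> h"
    then show "coef p g \<noteq> coef p h" using generic_separates[OF p] by blast
  qed
qed

definition diag_op :: "('a \<Rightarrow> complex) \<Rightarrow> 'a \<Rightarrow> 'a \<Rightarrow> complex" where
  "diag_op d k g = (if k = g then d g else 0)"

lemma sum_diag_op:
  "finite S \<Longrightarrow> k \<in> S \<Longrightarrow> (\<Sum>g\<in>S. diag_op d k g * f g) = d k * f k"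
proof -
  assume S: "finite S" "k \<in> S"
  have "(\<Sum>g\<in>S. diag_op d k g * f g) = (\<Sum>g\<in>S. if k = g then d g * f g else 0)"
    by (intro sum.cong) (auto simp: diag_op_def)
  then show ?thesis using S by simp
qed

lemma lin_op_diag:
  assumes "finite (carrier G)"
  shows "lin_op G (diag_op d) f = restrict (\<lambda>k. d k * f k) (carrier G)"
  unfolding lin_op_def using assms by (auto simp: sum_diag_op intro!: restrict_ext)

text \<open>For diagonal operators the Schur product convolves the eigenvalue functions and divides
  by the group order, so eigenvalues \<open>?n * q g\<close> turn Schur idempotence into convolution
  idempotence of \<open>q\<close>. Conjugation replaces the eigenvalue at \<open>g\<close> by the
  conjugate of that at \<open>inv g\<close>.\<close>

lemma quantum_graph_diag:
  fixes G :: "'a monoid" (structure)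
  assumes "group G" and fin: "finite (carrier G)"
    and idem: "\<And>l. l \<in> carrier G \<Longrightarrow> (\<Sum>h\<in>carrier G. q h * q (inv h \<otimes> l)) = q l"
    and selfadj: "\<And>g. g \<in> carrier G \<Longrightarrow> cnj (q (inv g)) = q g"
  shows "quantum_graph G (diag_op (\<lambda>g. of_nat (card (carrier G)) * q g))"
proof -
  interpret group G by fact
  let ?n = "of_nat (card (carrier G)) :: complex"
  let ?a = "diag_op (\<lambda>g. ?n * q g)"
  have n: "?n \<noteq> 0" using fin by (auto simp: card_gt_0_iff)
  have "schur_op G ?a ?a f = lin_op G ?a f" for f
  proof -
    have "(\<Sum>h\<in>carrier G. tensor_op G ?a ?a (cg_comult_adj G f) (h, inv h \<otimes> l)) = ?n * q l * f l"
      if l: "l \<in> carrier G" for l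
    proof -
      have "tensor_op G ?a ?a (cg_comult_adj G f) (h, inv h \<otimes> l) = q h * q (inv h \<otimes> l) * (?n * f l)"
        if h: "h \<in> carrier G" for h
      proof -
        have "tensor_op G ?a ?a (cg_comult_adj G f) (h, inv h \<otimes> l) =
            (\<Sum>g\<in>carrier G. ?a h g * (\<Sum>g'\<in>carrier G. ?a (inv h \<otimes> l) g' * cg_comult_adj G f (g, g')))"
          using h l by (simp add: tensor_op_def sum_distrib_left mult.assoc)
        also have "\<dots> = ?n * q h * (?n * q (inv h \<otimes> l) * cg_comult_adj G f (h, inv h \<otimes> l))"
          using h l fin by (simp add: sum_diag_op)
        also have "cg_comult_adj G f (h, inv h \<otimes> l) = f l / ?n"
          using h l by (simp add: cg_comult_adj_def m_assoc[symmetric])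
        finally show ?thesis using n by simp
      qed
      then show ?thesis using idem[OF l] by (simp add: sum_distrib_right[symmetric])
    qed
    then show ?thesis
      unfolding schur_op_def cg_mult_map_def lin_op_diag[OF fin] by (auto intro!: restrict_ext)
  qed
  moreover have "conj_op G ?a f = lin_op G ?a f" for f
  proof -
    have "cnj (?n * q (inv g) * cnj (f g)) = ?n * q g * f g" if "g \<in> carrier G" for g
      using selfadj[OF that] by simp
    then show ?thesis
      unfolding conj_op_def lin_op_diag[OF fin] cg_star_def by (auto intro!: restrict_ext)
  qed
  ultimately show ?thesis by (simp add: quantum_graph_def)
qed

section \<open>Classical automorphisms\<close>

definition cg_delta :: "'a monoid \<Rightarrow> 'a \<Rightarrow> 'a \<Rightarrow> complex" where
  "cg_delta G g = restrict (\<lambda>x. if x = g then 1 else 0) (carrier G)"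

lemma classical_aut_trivial:
  fixes G :: "'a monoid" (structure)
  assumes grp: "group G" and fin: "finite (carrier G)" and perf: "perfect_group G"
    and sep: "\<And>g h k. g \<in> carrier G \<Longrightarrow> h \<in> carrier G \<Longrightarrow> k \<in> carrier G \<Longrightarrow> k \<otimes> g \<noteq> g \<otimes> k \<Longrightarrow> g \<noteq> h \<Longrightarrow> d g \<noteq> d h"
    and phi: "\<phi> \<in> classical_aut G (diag_op d)" and f: "f \<in> cg_space G"
  shows "\<phi> f = f"
proof -
  interpret group G by fact
  let ?e = "cg_delta G"
  have bij: "bij_betw \<phi> (cg_space G) (cg_space G)"
    and add: "\<And>f g. f \<in> cg_space G \<Longrightarrow> g \<in> cg_space G \<Longrightarrow> \<phi> (cg_add G f g) = cg_add G (\<phi> f) (\<phi> g)"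
    and smult: "\<And>c f. f \<in> cg_space G \<Longrightarrow> \<phi> (cg_smult G c f) = cg_smult G c (\<phi> f)"
    and mult: "\<And>f g. f \<in> cg_space G \<Longrightarrow> g \<in> cg_space G \<Longrightarrow> \<phi> (cg_mult G f g) = cg_mult G (\<phi> f) (\<phi> g)"
    and one: "\<phi> (cg_one G) = cg_one G"
    and comm: "\<And>f. f \<in> cg_space G \<Longrightarrow> \<phi> (lin_op G (diag_op d) f) = lin_op G (diag_op d) (\<phi> f)"
    using phi by (auto simp: classical_aut_def star_automorphism_def)
  have ph: "\<phi> f \<in> cg_space G" if "f \<in> cg_space G" for f using bij that by (rule bij_betwE[rule_format])
  have eS: "?e g \<in> cg_space G" for g by (simp add: cg_delta_def cg_space_def)
  have e1: "?e \<one> = cg_one G" by (simp add: cg_delta_def cg_one_def)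
  have smult_mult: "cg_mult G (cg_smult G b (?e g)) (cg_smult G c (?e h)) = cg_smult G (b * c) (?e (g \<otimes> h))"
    if gh: "g \<in> carrier G" "h \<in> carrier G" for b c g h
  proof -
    have "(\<Sum>k\<in>carrier G. cg_smult G b (?e g) k * cg_smult G c (?e h) (inv k \<otimes> l))
        = b * c * (if l = g \<otimes> h then 1 else 0)" if l: "l \<in> carrier G" for l
    proof -
      have "inv g \<otimes> l = h \<longleftrightarrow> l = g \<otimes> h" using l gh by (intro inv_solve_left')
      then have "(\<Sum>k\<in>carrier G. cg_smult G b (?e g) k * cg_smult G c (?e h) (inv k \<otimes> l))
          = (\<Sum>k\<in>carrier G. if k = g then b * c * (if l = g \<otimes> h then 1 else 0) else 0)"
        using l gh by (intro sum.cong refl) (auto simp: cg_smult_def cg_delta_def)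
      then show ?thesis using fin gh by simp
    qed
    then show ?thesis unfolding cg_mult_def
      by (auto simp: cg_smult_def cg_delta_def restrict_def fun_eq_iff)
  qed
  have smult1: "cg_smult G 1 (?e g) = ?e g" for g by (auto simp: cg_smult_def cg_delta_def)
  have ee: "?e (g \<otimes> h) = cg_mult G (?e g) (?e h)" if "g \<in> carrier G" "h \<in> carrier G" for g h
    using smult_mult[OF that, of 1 1] by (simp add: smult1)
  define eig where "eig g \<longleftrightarrow> (\<exists>c. \<phi> (?e g) = cg_smult G c (?e g))" for g
  have eig_mult: "eig (g \<otimes> h)" if "eig g" "eig h" "g \<in> carrier G" "h \<in> carrier G" for g h
    using that unfolding eig_def by (metis ee eS mult smult_mult)
  have eig_noncentral: "eig g" if g: "g \<in> carrier G" and k: "k \<in> carrier G" "k \<otimes> g \<noteq> g \<otimes> k" for g k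
  proof -
    have "lin_op G (diag_op d) (?e g) = cg_smult G (d g) (?e g)"
      by (auto simp: lin_op_diag fin cg_smult_def cg_delta_def)
    then have eq: "cg_smult G (d g) (\<phi> (?e g)) = lin_op G (diag_op d) (\<phi> (?e g))"
      using comm[OF eS, of g] smult[OF eS] by simp
    have dd: "d g * \<phi> (?e g) h = d h * \<phi> (?e g) h" if "h \<in> carrier G" for h
      using that fun_cong[OF eq, of h] by (simp add: lin_op_diag fin cg_smult_def)
    \<comment> \<open>The image of \<open>?e g\<close> is an eigenvector for \<open>d g\<close>, and
      separation makes this eigenspace the line through \<open>?e g\<close>.\<close>
    have zero: "\<phi> (?e g) h = 0" if "h \<in> carrier G" "h \<noteq> g" for h
      using dd[OF that(1)] sep[OF g that(1) k] that by auto
    have "\<phi> (?e g) = cg_smult G (\<phi> (?e g) g) (?e g)"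
    proof (rule extensionalityI[of _ "carrier G"])
      show "\<phi> (?e g) \<in> extensional (carrier G)" using ph[OF eS] by (simp add: cg_space_def)
    next
      fix x assume x: "x \<in> carrier G"
      have "?e g x = (if x = g then 1 else 0)" using x by (simp add: cg_delta_def)
      then show "\<phi> (?e g) x = cg_smult G (\<phi> (?e g) g) (?e g) x"
        using x zero[OF x] by (auto simp: cg_smult_def)
    qed (simp add: cg_smult_def)
    then show ?thesis unfolding eig_def by blast
  qed
  have eig: "eig z" if z: "z \<in> carrier G" for z
  proof (cases "\<exists>m\<in>carrier G. \<exists>k\<in>carrier G. k \<otimes> m \<noteq> m \<otimes> k")
    case False
    \<comment> \<open>Without non-central elements the group is abelian, and being perfect it is
      trivial.\<close>
    have "{\<one>} = carrier G"
    proof (rule perfect_subgroup_eq[OF grp perf triv_subgroup])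
      fix k l assume kl: "k \<in> carrier G" "l \<in> carrier G"
      then have "k \<otimes> l = l \<otimes> k" using False by blast
      then have "k \<otimes> l \<otimes> inv k \<otimes> inv l = l \<otimes> (k \<otimes> inv k) \<otimes> inv l"
        using kl by (simp only: m_assoc m_closed inv_closed)
      then show "k \<otimes> l \<otimes> inv k \<otimes> inv l \<in> {\<one>}" using kl by simp
    qed
    then have "z = \<one>" using z by blast
    then show ?thesis unfolding eig_def by (metis e1 one smult1)
  next
    case True
    then obtain m k where mk: "m \<in> carrier G" "k \<in> carrier G" "k \<otimes> m \<noteq> m \<otimes> k" by blast
    show ?thesis
    \<comment> \<open>If \<open>inv m \<otimes> z\<close> does not commute with \<open>k\<close>,
      then \<open>z\<close> is the product of the non-central elements \<open>m\<close> and
      \<open>inv m \<otimes> z\<close>. If it does, \<open>z\<close> itself cannot commute with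
      \<open>k\<close>, since otherwise \<open>m\<close> would.\<close>
    proof (cases "k \<otimes> (inv m \<otimes> z) = (inv m \<otimes> z) \<otimes> k")
      case False
      have "eig (m \<otimes> (inv m \<otimes> z))"
        by (rule eig_mult) (use mk z False eig_noncentral in auto)
      then show ?thesis using mk z by (simp add: m_assoc[symmetric])
    next
      case True
      have "k \<otimes> z \<noteq> z \<otimes> k"
      proof
        assume kz: "k \<otimes> z = z \<otimes> k"
        have "m \<otimes> (k \<otimes> inv m) \<otimes> z = m \<otimes> (k \<otimes> (inv m \<otimes> z))" using mk z by (simp add: m_assoc)
        also have "\<dots> = m \<otimes> inv m \<otimes> (z \<otimes> k)" unfolding True using mk z by (simp only: m_assoc m_closed inv_closed)
        also have "\<dots> = k \<otimes> z" using mk z kz by simp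
        finally have "m \<otimes> (k \<otimes> inv m) = k" using mk z by (simp only: r_cancel m_closed inv_closed)
        then have "m \<otimes> (k \<otimes> inv m) \<otimes> m = k \<otimes> m" by simp
        then show False using mk by (simp add: m_assoc)
      qed
      then show ?thesis using eig_noncentral[OF z mk(2)] by blast
    qed
  qed
  then obtain c where c: "\<phi> (?e g) = cg_smult G (c g) (?e g)" if "g \<in> carrier G" for g
    unfolding eig_def by metis
  have inj: "b = c" if "cg_smult G b (?e g) = cg_smult G c (?e g)" "g \<in> carrier G" for b c g
    using fun_cong[OF that(1), of g] that(2) by (simp add: cg_smult_def cg_delta_def)
  have c_mult: "c (g \<otimes> h) = c g * c h" if "g \<in> carrier G" "h \<in> carrier G" for g h
  proof (rule inj[of _ "g \<otimes> h"])
    have "cg_smult G (c (g \<otimes> h)) (?e (g \<otimes> h)) = cg_mult G (\<phi> (?e g)) (\<phi> (?e h))"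
      using that c[of "g \<otimes> h"] by (simp add: ee mult eS)
    also have "\<dots> = cg_smult G (c g * c h) (?e (g \<otimes> h))"
      using that by (simp add: c smult_mult)
    finally show "cg_smult G (c (g \<otimes> h)) (?e (g \<otimes> h)) = cg_smult G (c g * c h) (?e (g \<otimes> h))" .
  qed (use that in simp)
  have c_one: "c \<one> = 1"
    by (rule inj[of _ \<one>]) (use c[of \<one>] smult1[of \<one>] in \<open>simp_all add: e1 one\<close>)
  have c_inv: "c g * c (inv g) = 1" if "g \<in> carrier G" for g
    using that c_one by (simp flip: c_mult)
  have "{g \<in> carrier G. c g = 1} = carrier G"
  proof (rule perfect_subgroup_eq[OF grp perf])
    show "subgroup {g \<in> carrier G. c g = 1} G"
    proof
      fix x assume "x \<in> {g \<in> carrier G. c g = 1}"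
      then show "inv x \<in> {g \<in> carrier G. c g = 1}" using c_inv[of x] by simp
    qed (auto simp: c_mult c_one)
    fix k l assume kl: "k \<in> carrier G" "l \<in> carrier G"
    then have "c (k \<otimes> l \<otimes> inv k \<otimes> inv l) = (c k * c (inv k)) * (c l * c (inv l))"
      by (simp add: c_mult)
    then show "k \<otimes> l \<otimes> inv k \<otimes> inv l \<in> {g \<in> carrier G. c g = 1}"
      using kl by (simp add: c_inv)
  qed
  then have "c g = 1" if "g \<in> carrier G" for g using that by blast
  then have fixed: "\<phi> (?e g) = ?e g" if "g \<in> carrier G" for g
    using c[OF that] that by (simp add: smult1)
  \<comment> \<open>Truncations of \<open>f\<close>: additivity of \<open>\<phi>\<close> is given
    for two summands, so \<open>f\<close> is built up one group element at a time.\<close>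
  define part where "part S = restrict (\<lambda>x. if x \<in> S then f x else 0) (carrier G)" for S
  have partS: "part S \<in> cg_space G" for S by (simp add: part_def cg_space_def)
  have "\<phi> (part S) = part S" if "finite S" "S \<subseteq> carrier G" for S
    using that
  proof (induction S rule: finite_induct)
    case empty
    have "part {} = cg_smult G 0 (cg_one G)" by (auto simp: part_def cg_smult_def cg_one_def)
    then show ?case using smult[of "cg_one G" 0] one by (simp add: cg_space_def cg_one_def)
  next
    case (insert g S)
    have eq: "part (insert g S) = cg_add G (cg_smult G (f g) (?e g)) (part S)"
      using insert.hyps by (auto simp: part_def cg_add_def cg_smult_def cg_delta_def restrict_def fun_eq_iff)
    have "cg_smult G (f g) (?e g) \<in> cg_space G" by (simp add: cg_smult_def cg_space_def)
    then show ?case unfolding eq using insert partS by (simp add: add smult eS fixed)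
  qed
  moreover have "part (carrier G) = f"
    using f by (auto simp: part_def cg_space_def extensional_def restrict_def fun_eq_iff)
  ultimately show ?thesis using fin by (metis order_refl)
qed

section \<open>The quantum automorphism group\<close>

lemma nc_finite_zero [simp]: "nc_finite nc_zero"
  by (simp add: nc_finite_def nc_zero_def)

lemma nc_finite_one [simp]: "nc_finite nc_one"
  by (simp add: nc_finite_def nc_one_def)

lemma nc_finite_gen [simp]: "nc_finite (nc_gen x)"
  by (simp add: nc_finite_def nc_gen_def)

lemma nc_finite_add [simp]: "nc_finite p \<Longrightarrow> nc_finite q \<Longrightarrow> nc_finite (nc_add p q)"
  unfolding nc_finite_def nc_add_def
  by (rule finite_subset[of _ "{w. p w \<noteq> 0} \<union> {w. q w \<noteq> 0}"]) auto

lemma nc_finite_sub [simp]: "nc_finite p \<Longrightarrow> nc_finite q \<Longrightarrow> nc_finite (nc_sub p q)"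
  unfolding nc_finite_def nc_sub_def
  by (rule finite_subset[of _ "{w. p w \<noteq> 0} \<union> {w. q w \<noteq> 0}"]) auto

lemma nc_finite_smult [simp]: "nc_finite p \<Longrightarrow> nc_finite (nc_smult c p)"
  unfolding nc_finite_def nc_smult_def
  by (rule finite_subset[of _ "{w. p w \<noteq> 0}"]) auto

lemma nc_finite_sum [simp]:
  assumes "\<And>i. i \<in> S \<Longrightarrow> nc_finite (F i)"
  shows "nc_finite (\<lambda>w. \<Sum>i\<in>S. F i w)"
  using assms
proof (induction S rule: infinite_finite_induct)
  case (insert i S)
  then have "nc_finite (nc_add (F i) (\<lambda>w. \<Sum>i\<in>S. F i w))" by simp
  then show ?case using insert.hyps by (simp add: nc_add_def)
qed (simp_all add: nc_finite_def)

lemma nc_mult_support: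
  "{w. nc_mult p q w \<noteq> 0} \<subseteq> (\<lambda>(u, v). u @ v) ` ({w. p w \<noteq> 0} \<times> {w. q w \<noteq> 0})"
proof safe
  fix w assume "nc_mult p q w \<noteq> 0"
  then obtain i where "p (take i w) * q (drop i w) \<noteq> 0"
    unfolding nc_mult_def by (meson sum.not_neutral_contains_not_neutral)
  then show "w \<in> (\<lambda>(u, v). u @ v) ` ({w. p w \<noteq> 0} \<times> {w. q w \<noteq> 0})"
    by (intro image_eqI[of _ _ "(take i w, drop i w)"]) auto
qed

lemma nc_finite_mult [simp]: "nc_finite p \<Longrightarrow> nc_finite q \<Longrightarrow> nc_finite (nc_mult p q)"
  using nc_mult_support[of p q] unfolding nc_finite_def by (meson finite_SigmaI finite_imageI finite_subset)

definition flip :: "('x \<times> bool) list \<Rightarrow> ('x \<times> bool) list" where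
  "flip w = rev (map (\<lambda>(x, b). (x, \<not> b)) w)"

lemma flip_flip [simp]: "flip (flip w) = w"
  by (induction w) (auto simp: flip_def rev_map)

lemma nc_star_flip: "nc_star p w = cnj (p (flip w))"
  by (simp add: nc_star_def flip_def)

lemma nc_star_support: "{w. nc_star p w \<noteq> 0} = flip ` {w. p w \<noteq> 0}"
  by (auto simp: nc_star_flip image_iff) (metis flip_flip)

lemma nc_finite_star [simp]: "nc_finite p \<Longrightarrow> nc_finite (nc_star p)"
  by (simp add: nc_finite_def nc_star_support)

lemma nc_mult_one_left [simp]: "nc_mult nc_one p = p"
proof
  fix w
  have "nc_mult nc_one p w = (\<Sum>i\<le>length w. if i = 0 then p w else 0)"
    unfolding nc_mult_def by (intro sum.cong) (auto simp: nc_one_def)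
  then show "nc_mult nc_one p w = p w" by simp
qed

lemma nc_mult_one_right [simp]: "nc_mult p nc_one = p"
proof
  fix w
  have "nc_mult p nc_one w = (\<Sum>i\<le>length w. if i = length w then p w else 0)"
    unfolding nc_mult_def by (intro sum.cong) (auto simp: nc_one_def)
  then show "nc_mult p nc_one w = p w" by simp
qed

lemma coact_sum: "coact G f h = (\<lambda>w. \<Sum>g\<in>carrier G. nc_smult (f g) (nc_gen (h, g)) w)"
  by (simp add: coact_def nc_smult_def)

lemma t_op_sum: "t_op G a F k = (\<lambda>w. \<Sum>h\<in>carrier G. nc_smult (a k h) (F h) w)"
  by (simp add: t_op_def nc_smult_def)

section \<open>Evaluation of the universal algebra in the group algebra\<close>

context group_ring
begin

text \<open>The character \<open>u\<^sub>h\<^sub>g \<mapsto> \<delta>\<^sub>h\<^sub>g L\<^sub>g\<close>: it describes the action of the compact quantum group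
  dual to the group by translations.\<close>

definition letter :: "('a \<times> 'a) \<times> bool \<Rightarrow> 'r" where
  "letter = (\<lambda>((h, g), b). if h = g \<and> g \<in> carrier G then (if b then L (inv g) else L g) else 0)"

definition word :: "(('a \<times> 'a) \<times> bool) list \<Rightarrow> 'r" where
  "word w = prod_list (map letter w)"

text \<open>Linear extension of \<open>word\<close>. A sum over an infinite support has the default
  value 0, so the homomorphism laws are stated for \<open>nc_finite\<close> arguments.\<close>

definition ev :: "'a qpoly \<Rightarrow> 'r" where
  "ev p = (\<Sum>w | p w \<noteq> 0. sc (p w) * word w)"

lemma letter_A [simp]: "letter x \<in> A"
  by (auto simp: letter_def split: prod.split)

lemma word_A [simp]: "word w \<in> A"
  by (induction w) (auto simp: word_def)

lemma word_append: "word (u @ v) = word u * word v"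
  by (simp add: word_def)

lemma word_flip: "word (flip w) = star (word w)"
proof (induction w)
  case (Cons x w)
  have "letter (case x of (y, b) \<Rightarrow> (y, \<not> b)) = star (letter x)"
    by (auto simp: letter_def star_L star_zero split: prod.split)
  moreover have "word (x # w) = letter x * word w" by (simp add: word_def)
  moreover have "flip (x # w) = flip w @ [case x of (y, b) \<Rightarrow> (y, \<not> b)]" by (simp add: flip_def)
  ultimately show ?case using Cons by (simp add: word_append star_mult) (simp add: word_def)
qed (simp add: word_def flip_def star_one)

lemma ev_A [simp]: "ev p \<in> A"
  by (simp add: ev_def)

lemma ev_superset:
  assumes "finite S" "{w. p w \<noteq> 0} \<subseteq> S"
  shows "ev p = (\<Sum>w\<in>S. sc (p w) * word w)"
  unfolding ev_def using assms by (intro sum.mono_neutral_left) (auto simp: sc_0)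

lemma ev_add: "nc_finite p \<Longrightarrow> nc_finite q \<Longrightarrow> ev (nc_add p q) = ev p + ev q"
  by (subst (1 2 3) ev_superset[of "{w. p w \<noteq> 0} \<union> {w. q w \<noteq> 0}"])
    (auto simp: nc_finite_def nc_add_def sc_add distrib_right sum.distrib)

lemma ev_sub: "nc_finite p \<Longrightarrow> nc_finite q \<Longrightarrow> ev (nc_sub p q) = ev p - ev q"
  by (subst (1 2 3) ev_superset[of "{w. p w \<noteq> 0} \<union> {w. q w \<noteq> 0}"])
    (auto simp: nc_finite_def nc_sub_def sc_diff left_diff_distrib sum_subtractf)

lemma ev_smult: "nc_finite p \<Longrightarrow> ev (nc_smult c p) = sc c * ev p"
  by (subst (1 2) ev_superset[of "{w. p w \<noteq> 0}"])
    (auto simp: nc_finite_def nc_smult_def sc_mult mult.assoc sum_distrib_left)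

lemma ev_zero: "ev nc_zero = 0"
  by (simp add: ev_def nc_zero_def)

lemma ev_one: "ev nc_one = 1"
  using ev_superset[of "{[]}" nc_one] by (simp add: nc_one_def sc_one word_def)

lemma ev_gen: "ev (nc_gen x) = letter (x, False)"
proof -
  have "{w. nc_gen x w \<noteq> 0} \<subseteq> {[(x, False)]}" by (auto simp: nc_gen_def)
  then show ?thesis using ev_superset[of "{[(x, False)]}" "nc_gen x"]
    by (simp add: nc_gen_def sc_one word_def)
qed

lemma ev_sum:
  assumes "\<And>i. i \<in> S \<Longrightarrow> nc_finite (F i)"
  shows "ev (\<lambda>w. \<Sum>i\<in>S. F i w) = (\<Sum>i\<in>S. ev (F i))"
  using assms
proof (induction S rule: infinite_finite_induct)
  case (insert i S)
  have "ev (nc_add (F i) (\<lambda>w. \<Sum>i\<in>S. F i w)) = ev (F i) + ev (\<lambda>w. \<Sum>i\<in>S. F i w)"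
    using insert.prems by (intro ev_add) auto
  then show ?case using insert by (simp add: nc_add_def)
qed (simp_all add: ev_def)

text \<open>A word with a cut position corresponds injectively, via \<open>j\<close>, to a pair of
  words. This matches the convolution in \<open>nc_mult\<close> with the product of the two sums;
  cuts that leave the supports contribute 0.\<close>

lemma ev_mult:
  assumes p: "nc_finite p" and q: "nc_finite q"
  shows "ev (nc_mult p q) = ev p * ev q"
proof -
  define P Q where "P = {w. p w \<noteq> 0}" and "Q = {w. q w \<noteq> 0}"
  define S where "S = (\<lambda>(u, v). u @ v) ` (P \<times> Q)"
  define j where "j = (\<lambda>(w :: (('a \<times> 'a) \<times> bool) list, i). (take i w, drop i w))"
  define F where "F = (\<lambda>(u, v). (sc (p u) * word u) * (sc (q v) * word v))"
  let ?T = "SIGMA w:S. {..length w}"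
  have fPQ: "finite P" "finite Q" using p q by (auto simp: P_def Q_def nc_finite_def)
  then have fS: "finite S" by (simp add: S_def)
  have "inj_on j ?T"
  proof (rule inj_onI)
    fix x y assume xy: "x \<in> ?T" "y \<in> ?T" "j x = j y"
    obtain w i v k where [simp]: "x = (w, i)" "y = (v, k)" by (cases x, cases y)
    have "take i w = take k v" "drop i w = drop k v" using xy by (auto simp: j_def)
    then have "w = v" by (metis append_take_drop_id)
    moreover have "length (take i w) = length (take k v)" using \<open>take i w = take k v\<close> by simp
    ultimately show "x = y" using xy by auto
  qed
  have sub: "P \<times> Q \<subseteq> j ` ?T"
  proof
    fix x assume x: "x \<in> P \<times> Q"
    obtain u v where [simp]: "x = (u, v)" by (cases x)
    have "x = j (u @ v, length u)" by (simp add: j_def)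
    moreover have "(u @ v, length u) \<in> ?T" using x by (auto simp: S_def)
    ultimately show "x \<in> j ` ?T" by blast
  qed
  have "ev p * ev q = (\<Sum>x\<in>P \<times> Q. F x)"
    unfolding ev_def P_def[symmetric] Q_def[symmetric] F_def by (simp add: sum_product sum.cartesian_product)
  also have "\<dots> = (\<Sum>x\<in>j ` ?T. F x)"
    by (rule sum.mono_neutral_left) (use sub fS in \<open>auto simp: F_def P_def Q_def sc_0\<close>)
  also have "\<dots> = (\<Sum>x\<in>?T. F (j x))" using sum.reindex[OF \<open>inj_on j ?T\<close>] by simp
  also have "\<dots> = (\<Sum>w\<in>S. \<Sum>i\<le>length w. F (j (w, i)))"
    using fS by (simp add: sum.Sigma)
  also have "\<dots> = (\<Sum>w\<in>S. sc (nc_mult p q w) * word w)"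
  proof (rule sum.cong[OF refl])
    fix w
    have "F (j (w, i)) = sc (p (take i w) * q (drop i w)) * word w" for i
      using word_append[of "take i w" "drop i w"]
      by (simp add: F_def j_def sc_mult mult.assoc sc_left_comm[of "word _"])
    then show "(\<Sum>i\<le>length w. F (j (w, i))) = sc (nc_mult p q w) * word w"
      by (simp add: nc_mult_def sc_sum sum_distrib_right)
  qed
  also have "\<dots> = ev (nc_mult p q)"
    using ev_superset[OF fS, of "nc_mult p q"] nc_mult_support[of p q] by (simp add: S_def P_def Q_def)
  finally show ?thesis by simp
qed

lemma star_sum: "(\<And>i. i \<in> S \<Longrightarrow> f i \<in> A) \<Longrightarrow> star (sum f S) = (\<Sum>i\<in>S. star (f i))"
  by (induction S rule: infinite_finite_induct) (auto simp: star_zero star_add)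

lemma ev_star: "ev (nc_star p) = star (ev p)"
proof -
  have "inj_on flip {w. p w \<noteq> 0}" by (rule inj_on_inverseI[of _ flip]) simp
  then have "ev (nc_star p) = (\<Sum>w | p w \<noteq> 0. sc (nc_star p (flip w)) * word (flip w))"
    unfolding ev_def nc_star_support by (simp add: sum.reindex)
  also have "\<dots> = star (ev p)"
    by (simp add: ev_def star_sum star_sc_mult nc_star_flip word_flip)
  finally show ?thesis .
qed

text \<open>Once the relations evaluate to 0, \<open>ev\<close> descends to the quotient, so a
  nonzero value certifies that an element does not vanish there.\<close>

lemma ev_star_ideal:
  assumes R: "\<And>r. r \<in> R \<Longrightarrow> nc_finite r \<and> ev r = 0" and x: "x \<in> star_ideal R"
  shows "nc_finite x \<and> ev x = 0"
  using x by induction (auto simp: R ev_zero ev_mult ev_star ev_add ev_smult star_zero)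

lemma nc_finite_coact [simp]: "nc_finite (coact G f h)"
  unfolding coact_sum by simp

lemma ev_coact:
  assumes "h \<in> carrier G"
  shows "ev (coact G f h) = sc (f h) * L h"
proof -
  have "ev (coact G f h) = (\<Sum>g\<in>carrier G. sc (f g) * letter ((h, g), False))"
    unfolding coact_sum by (simp add: ev_sum ev_smult ev_gen)
  also have "\<dots> = (\<Sum>g\<in>carrier G. if g = h then sc (f h) * L h else 0)"
    by (intro sum.cong) (auto simp: letter_def)
  finally show ?thesis using fin assms by simp
qed

lemma ev_sub_eq_0:
  assumes "nc_finite p" "nc_finite q" "ev p = ev q"
  shows "nc_finite (nc_sub p q) \<and> ev (nc_sub p q) = 0"
  using assms by (simp add: ev_sub)

text \<open>The fundamental matrix becomes diagonal with the unitary entries \<open>L g\<close>.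
  Multiplicativity of \<open>L\<close> gives the algebra relations, and commutation with the
  operator holds because both are diagonal in the same basis.\<close>

lemma ev_qut_rels:
  assumes "r \<in> qut_rels G (diag_op d)"
  shows "nc_finite r \<and> ev r = 0"
  using assms unfolding qut_rels_def
proof (elim UnE)
  assume "r \<in> (\<Union>f\<in>cg_space G. \<Union>f'\<in>cg_space G. (\<lambda>h. nc_sub (coact G (cg_mult G f f') h)
                                       (t_mult G (coact G f) (coact G f') h)) ` carrier G)"
  then obtain f f' h where h: "h \<in> carrier G"
    and r: "r = nc_sub (coact G (cg_mult G f f') h) (t_mult G (coact G f) (coact G f') h)" by blast
  have "ev (t_mult G (coact G f) (coact G f') h) =
      (\<Sum>k\<in>carrier G. (sc (f k) * L k) * (sc (f' (inv k \<otimes> h)) * L (inv k \<otimes> h)))"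
    unfolding t_mult_def using h by (simp add: ev_sum ev_mult ev_coact)
  also have "\<dots> = (\<Sum>k\<in>carrier G. sc (f k * f' (inv k \<otimes> h)) * L h)"
  proof (intro sum.cong refl)
    fix k assume k: "k \<in> carrier G"
    have "L k * L (inv k \<otimes> h) = L h" using k h by (simp add: m_assoc[symmetric] flip: L_mult)
    then show "(sc (f k) * L k) * (sc (f' (inv k \<otimes> h)) * L (inv k \<otimes> h)) = sc (f k * f' (inv k \<otimes> h)) * L h"
      by (simp add: sc_mult mult.assoc sc_left_comm[of "L k"])
  qed
  also have "\<dots> = ev (coact G (cg_mult G f f') h)"
    using h by (simp add: ev_coact cg_mult_def sc_sum sum_distrib_right)
  finally show ?thesis unfolding r by (intro ev_sub_eq_0) (auto simp: t_mult_def)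
next
  assume "r \<in> (\<Union>f\<in>cg_space G. (\<lambda>h. nc_sub (coact G (cg_star G f) h) (t_star G (coact G f) h)) ` carrier G)"
  then obtain f h where h: "h \<in> carrier G"
    and r: "r = nc_sub (coact G (cg_star G f) h) (t_star G (coact G f) h)" by blast
  show ?thesis unfolding r t_star_def
    using h by (intro ev_sub_eq_0) (auto simp: ev_star ev_coact star_sc_mult star_L cg_star_def)
next
  assume "r \<in> (\<lambda>h. nc_sub (coact G (cg_one G) h) (t_one G h)) ` carrier G"
  then obtain h where h: "h \<in> carrier G" and r: "r = nc_sub (coact G (cg_one G) h) (t_one G h)" by blast
  show ?thesis unfolding r t_one_def
    using h by (intro ev_sub_eq_0) (auto simp: ev_coact cg_one_def ev_one ev_zero sc_one sc_0 L_one)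
next
  assume "r \<in> (\<lambda>f. nc_sub (t_psi G (coact G f)) (nc_smult (cg_psi G f) nc_one)) ` cg_space G"
  then obtain f where r: "r = nc_sub (t_psi G (coact G f)) (nc_smult (cg_psi G f) nc_one)" by blast
  show ?thesis unfolding r t_psi_def cg_psi_def
    by (intro ev_sub_eq_0) (auto simp: ev_smult ev_coact ev_one L_one sc_mult)
next
  assume "r \<in> (\<Union>f\<in>cg_space G. (\<lambda>k. nc_sub (t_op G (diag_op d) (coact G f) k)
      (coact G (lin_op G (diag_op d) f) k)) ` carrier G)"
  then obtain f k where k: "k \<in> carrier G"
    and r: "r = nc_sub (t_op G (diag_op d) (coact G f) k) (coact G (lin_op G (diag_op d) f) k)" by blast
  have "ev (t_op G (diag_op d) (coact G f) k) = (\<Sum>h\<in>carrier G. sc (diag_op d k h * f h) * L h)"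
    unfolding t_op_sum by (simp add: ev_sum ev_smult ev_coact sc_mult mult.assoc)
  also have "\<dots> = (\<Sum>h\<in>carrier G. if k = h then sc (d k * f k) * L k else 0)"
    by (intro sum.cong) (auto simp: diag_op_def sc_0)
  also have "\<dots> = ev (coact G (lin_op G (diag_op d) f) k)"
    using k fin by (simp add: ev_coact lin_op_diag)
  finally show ?thesis unfolding r by (intro ev_sub_eq_0) (auto simp: t_op_sum)
next
  assume "r \<in> (\<lambda>(g, k). nc_sub (\<lambda>w. \<Sum>h\<in>carrier G. nc_mult (nc_star (nc_gen (h, g))) (nc_gen (h, k)) w)
                       (if g = k then nc_one else nc_zero)) ` (carrier G \<times> carrier G)"
  then obtain g k where gk: "g \<in> carrier G" "k \<in> carrier G"
    and r: "r = nc_sub (\<lambda>w. \<Sum>h\<in>carrier G. nc_mult (nc_star (nc_gen (h, g))) (nc_gen (h, k)) w)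
                       (if g = k then nc_one else nc_zero)" by auto
  have "ev (\<lambda>w. \<Sum>h\<in>carrier G. nc_mult (nc_star (nc_gen (h, g))) (nc_gen (h, k)) w)
      = (\<Sum>h\<in>carrier G. star (letter ((h, g), False)) * letter ((h, k), False))"
    by (simp add: ev_sum ev_mult ev_star ev_gen)
  also have "\<dots> = (\<Sum>h\<in>carrier G. if h = g then if g = k then 1 else 0 else 0)"
    by (intro sum.cong) (auto simp: letter_def star_L star_zero L_one simp flip: L_mult)
  finally show ?thesis unfolding r
    using gk fin by (intro ev_sub_eq_0) (auto simp: ev_one ev_zero)
next
  assume "r \<in> (\<lambda>(g, k). nc_sub (\<lambda>w. \<Sum>h\<in>carrier G. nc_mult (nc_gen (g, h)) (nc_star (nc_gen (k, h))) w)
                       (if g = k then nc_one else nc_zero)) ` (carrier G \<times> carrier G)"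
  then obtain g k where gk: "g \<in> carrier G" "k \<in> carrier G"
    and r: "r = nc_sub (\<lambda>w. \<Sum>h\<in>carrier G. nc_mult (nc_gen (g, h)) (nc_star (nc_gen (k, h))) w)
                       (if g = k then nc_one else nc_zero)" by auto
  have "ev (\<lambda>w. \<Sum>h\<in>carrier G. nc_mult (nc_gen (g, h)) (nc_star (nc_gen (k, h))) w)
      = (\<Sum>h\<in>carrier G. letter ((g, h), False) * star (letter ((k, h), False)))"
    by (simp add: ev_sum ev_mult ev_star ev_gen)
  also have "\<dots> = (\<Sum>h\<in>carrier G. if h = g then if g = k then 1 else 0 else 0)"
    by (intro sum.cong) (auto simp: letter_def star_L star_zero L_one simp flip: L_mult)
  finally show ?thesis unfolding r
    using gk fin by (intro ev_sub_eq_0) (auto simp: ev_one ev_zero)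
qed

text \<open>Evaluating the fixed point condition at \<open>h\<close> gives
  \<open>sc (c h) * L h = sc (c h) * L \<one>\<close>, and distinct group elements are linearly
  independent.\<close>

lemma fixed_point_scalar:
  assumes c: "c \<in> qut_fixed_points G (diag_op d)"
  shows "c = cg_smult G (c \<one>) (cg_one G)"
proof -
  have "c h = 0" if h: "h \<in> carrier G" "h \<noteq> \<one>" for h
  proof -
    have "nc_sub (coact G c h) (nc_smult (c h) nc_one) \<in> star_ideal (qut_rels G (diag_op d))"
      using c h by (simp add: qut_fixed_points_def)
    then have "ev (nc_sub (coact G c h) (nc_smult (c h) nc_one)) = 0"
      using ev_star_ideal[of "qut_rels G (diag_op d)"] ev_qut_rels by blast
    then have "sc (c h) * L h = sc (c h) * L \<one>"
      using h by (simp add: ev_sub ev_coact ev_smult ev_one L_one)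
    then have "coef (sc (c h) * L h) h = coef (sc (c h) * L \<one>) h" by simp
    then show ?thesis using h by (simp add: coef_sc coef_L)
  qed
  moreover have "c \<in> extensional (carrier G)"
    using c by (simp add: qut_fixed_points_def cg_space_def)
  ultimately show ?thesis
    by (intro extensionalityI[of _ "carrier G"]) (auto simp: cg_smult_def cg_one_def)
qed

end

lemma scalar_fixed_point: "cg_smult G z (cg_one G) \<in> qut_fixed_points G a"
proof -
  have "nc_sub (coact G (cg_smult G z (cg_one G)) h) (nc_smult (cg_smult G z (cg_one G) h) nc_one)
      \<in> star_ideal (qut_rels G a)" if h: "h \<in> carrier G" for h
  proof -
    let ?r = "nc_sub (coact G (cg_one G) h) (t_one G h)"
    have "?r \<in> qut_rels G a" unfolding qut_rels_def using h by blast
    \<comment> \<open>The element in question is \<open>z\<close> times the unitality relation at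
      \<open>h\<close>; the factors \<open>nc_one\<close> bring it into the shape of the ideal
      rule.\<close>
    then have "nc_smult z (nc_mult (nc_mult nc_one ?r) nc_one) \<in> star_ideal (qut_rels G a)"
      by (intro star_ideal.smult star_ideal.rel) auto
    moreover have "nc_smult z (nc_mult (nc_mult nc_one ?r) nc_one) =
        nc_sub (coact G (cg_smult G z (cg_one G)) h) (nc_smult (cg_smult G z (cg_one G) h) nc_one)"
      using h by (auto simp: nc_sub_def nc_smult_def coact_def t_one_def cg_smult_def cg_one_def nc_zero_def
          fun_eq_iff right_diff_distrib sum_distrib_left mult.assoc)
    ultimately show ?thesis by simp
  qed
  then show ?thesis by (simp add: qut_fixed_points_def cg_space_def cg_smult_def)
qed

lemma qut_transitive_diag:
  assumes "group G" "finite (carrier G)"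
  shows "qut_transitive G (diag_op d)"
proof -
  interpret group_ring G "cend_transl G" cend_scalar by (rule group_ring_cend) fact+
  show ?thesis
    unfolding qut_transitive_def using fixed_point_scalar scalar_fixed_point by blast
qed

theorem theorem6p4:
  fixes G :: "'a monoid"
  assumes "group G" and "finite (carrier G)" and "perfect_group G"
  shows "\<exists>a. quantum_graph G a \<and>
             (\<forall>\<phi>\<in>classical_aut G a. \<forall>f\<in>cg_space G. \<phi> f = f) \<and>
             qut_transitive G a"
proof -
  let ?n = "of_nat (card (carrier G)) :: complex"
  \<comment> \<open>A nonzero factor keeps distinct values of \<open>q\<close> distinct.\<close>
  have n: "?n \<noteq> 0"
    using assms(2) group.is_monoid[OF assms(1)] monoid.one_closed by (fastforce simp: card_gt_0_iff)
  obtain q :: "'a \<Rightarrow> complex" where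
    q: "\<And>l. l \<in> carrier G \<Longrightarrow> (\<Sum>h\<in>carrier G. q h * q (inv\<^bsub>G\<^esub> h \<otimes>\<^bsub>G\<^esub> l)) = q l"
      "\<And>g. g \<in> carrier G \<Longrightarrow> cnj (q (inv\<^bsub>G\<^esub> g)) = q g"
    and sep: "\<And>g h k. g \<in> carrier G \<Longrightarrow> h \<in> carrier G \<Longrightarrow> k \<in> carrier G \<Longrightarrow>
      k \<otimes>\<^bsub>G\<^esub> g \<noteq> g \<otimes>\<^bsub>G\<^esub> k \<Longrightarrow> g \<noteq> h \<Longrightarrow> q g \<noteq> q h"
    using exists_separating_projection[OF assms] by blast
  let ?a = "diag_op (\<lambda>g. ?n * q g)"
  have "quantum_graph G ?a" by (rule quantum_graph_diag) (use assms q in auto)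
  moreover have "\<phi> f = f" if "\<phi> \<in> classical_aut G ?a" "f \<in> cg_space G" for \<phi> f
    by (rule classical_aut_trivial[OF assms _ that]) (use sep n in auto)
  ultimately show ?thesis using qut_transitive_diag[OF assms(1,2)] by blast
qed

end
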